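(* Let $\mathcal H$ be a complex Hilbert space and let $\mathbf A=(A_1,\dots,A_m)$ be an $m$-tuple of bounded operators on $\mathcal H$. The following conditions are equivalent. (a) $W_k(\mathbf A)$ is polyhedral for all positive integers $k<\dim\mathcal H$. (b) $\operatorname{conv}W_k(\mathbf A)$ is polyhedral for all positive integers $k<\dim\mathcal H$. (c) There is a unitary operator $U$ on $\mathcal H$ such that $U^*A_jU=D_j\oplus C_j$ for $j=1,\dots,m$, where $D_j=\operatorname{diag}(d_1^{(j)},d_2^{(j)},\dots)$, and $W_k(\mathbf A)=W_k(D_1,\dots,D_m)$ is polyhedral for all positive integers $k<\dim\mathcal H$.
   Context: For an $m$-tuple $\mathbf A=(A_1,\dots,A_m)$ of bounded operators on a complex Hilbert space $\mathcal H$ and a positive integer $k\le\dim\mathcal H$, the joint $k$-numerical range is $$W_k(\mathbf A)=\Big\{\Big(\sum_{\ell=1}^k\langle A_1x_\ell,x_\ell\rangle,\dots,\sum_{\ell=1}^k\langle A_mx_\ell,x_\ell\rangle\Big):\{x_1,\dots,x_k\}\subseteq\mathcal H\text{ orthonormal}\Big\}\subseteq\mathbb C^m.$$ A set is polyhedral if it is the convex hull of a finite set; $\operatorname{conv}$ denotes convex hull. In (c) the direct sums are all with respect to the same orthogonal decomposition of $\mathcal H$; the first summand is separable and the $D_j$ are diagonal with respect to one common, at most countable, orthonormal basis of it; the second summand may be absent. *)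

theory Defs
  imports "HOL-Analysis.Analysis" "HOL-Library.Extended_Nat"
begin

text \<open>
  The library has no complex inner product spaces. The inner product is linear in its first
  argument. Positive definiteness is contained in the last axiom, because \<^term>\<open>norm\<close> is
  already a norm.
\<close>

class complex_inner = real_normed_vector +
  fixes scaleC :: "complex \<Rightarrow> 'a \<Rightarrow> 'a" (infixr \<open>*\<^sub>C\<close> 75)
    and cinner :: "'a \<Rightarrow> 'a \<Rightarrow> complex"
  assumes scaleC_add_right: "c *\<^sub>C (x + y) = c *\<^sub>C x + c *\<^sub>C y"
    and scaleC_add_left: "(b + c) *\<^sub>C x = b *\<^sub>C x + c *\<^sub>C x"
    and scaleC_scaleC: "b *\<^sub>C (c *\<^sub>C x) = (b * c) *\<^sub>C x"
    and scaleC_of_real: "complex_of_real r *\<^sub>C x = r *\<^sub>R x"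
    and cinner_commute: "cinner x y = cnj (cinner y x)"
    and cinner_add_left: "cinner (x + y) z = cinner x z + cinner y z"
    and cinner_scaleC_left: "cinner (c *\<^sub>C x) y = c * cinner x y"
    and cinner_self: "cinner x x = complex_of_real ((norm x)\<^sup>2)"

class chilbert_space = complex_inner + complete_space

lemma scaleC_one: "1 *\<^sub>C (x :: 'a :: complex_inner) = x"
  using scaleC_of_real[of 1 x] by simp

global_interpretation complex_vector: vector_space "scaleC :: complex \<Rightarrow> 'a \<Rightarrow> 'a :: complex_inner"
  defines csubspace = complex_vector.subspace
    and cspan = complex_vector.span
    and cdim = complex_vector.dim
  by unfold_locales (simp_all add: scaleC_add_right scaleC_add_left scaleC_scaleC scaleC_one)

text \<open>
  Only comparisons of the dimension with natural numbers matter, so all infinite Hilbert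
  dimensions are identified. A Hilbert space has an infinite orthonormal basis iff it is
  infinite-dimensional as a vector space, and otherwise the two dimensions agree.
\<close>

definition hdim :: "'a :: complex_inner itself \<Rightarrow> enat" where
  "hdim _ = (if \<exists>B :: 'a set. finite B \<and> cspan B = UNIV then enat (cdim (UNIV :: 'a set)) else \<infinity>)"

definition bounded_clinear :: "('a :: complex_inner \<Rightarrow> 'a) \<Rightarrow> bool" where
  "bounded_clinear T \<longleftrightarrow> bounded_linear T \<and> (\<forall>c x. T (c *\<^sub>C x) = c *\<^sub>C T x)"

definition cadjoint :: "('a :: complex_inner \<Rightarrow> 'a) \<Rightarrow> 'a \<Rightarrow> 'a" where
  "cadjoint T = (THE S. \<forall>x y. cinner (T x) y = cinner x (S y))"

definition unitary :: "('a :: complex_inner \<Rightarrow> 'a) \<Rightarrow> bool" where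
  "unitary U \<longleftrightarrow> bounded_clinear U \<and> surj U \<and> (\<forall>x y. cinner (U x) (U y) = cinner x y)"

definition orthonormal_family :: "'i set \<Rightarrow> ('i \<Rightarrow> 'a :: complex_inner) \<Rightarrow> bool" where
  "orthonormal_family I x \<longleftrightarrow> (\<forall>i\<in>I. \<forall>j\<in>I. cinner (x i) (x j) = (if i = j then 1 else 0))"

definition orthonormal_basis_of :: "'a :: complex_inner set \<Rightarrow> 'i set \<Rightarrow> ('i \<Rightarrow> 'a) \<Rightarrow> bool" where
  "orthonormal_basis_of M I e \<longleftrightarrow> orthonormal_family I e \<and> closure (cspan (e ` I)) = M"

definition ortho_compl :: "'a :: complex_inner set \<Rightarrow> 'a set" where
  "ortho_compl M = {y. \<forall>x\<in>M. cinner x y = 0}"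

text \<open>
  \<open>direct_sum_on M T D C\<close> says that \<open>T = D \<oplus> C\<close> with respect to the decomposition of the whole
  space into the closed subspace \<open>M\<close> and its orthogonal complement. Only the values of \<open>D\<close> on
  \<open>M\<close> and of \<open>C\<close> on the complement are relevant; there they are restrictions of \<open>T\<close>, hence
  linear and bounded when \<open>T\<close> is.
\<close>

definition direct_sum_on ::
  "'a :: complex_inner set \<Rightarrow> ('a \<Rightarrow> 'a) \<Rightarrow> ('a \<Rightarrow> 'a) \<Rightarrow> ('a \<Rightarrow> 'a) \<Rightarrow> bool" where
  "direct_sum_on M T D C \<longleftrightarrow>
     D ` M \<subseteq> M \<and> C ` ortho_compl M \<subseteq> ortho_compl M \<and>
     (\<forall>x\<in>M. \<forall>y\<in>ortho_compl M. T (x + y) = D x + C y)"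

text \<open>
  The joint \<open>k\<close>-numerical range of a tuple of operators acting on the closed subspace \<open>M\<close>.
\<close>

definition joint_numrange_on ::
  "'a :: complex_inner set \<Rightarrow> nat \<Rightarrow> ('m \<Rightarrow> 'a \<Rightarrow> 'a) \<Rightarrow> (complex ^ 'm) set" where
  "joint_numrange_on M k A =
     {(\<chi> j. \<Sum>l<k. cinner (A j (x l)) (x l)) | x :: nat \<Rightarrow> 'a.
        orthonormal_family {..<k} x \<and> x ` {..<k} \<subseteq> M}"

abbreviation joint_numrange ::
  "nat \<Rightarrow> ('m \<Rightarrow> 'a :: complex_inner \<Rightarrow> 'a) \<Rightarrow> (complex ^ 'm) set" where
  "joint_numrange \<equiv> joint_numrange_on UNIV"

end

theory Submission
  imports Defs
begin

text \<open>
  Only the step from (b) to (c) needs an argument. A vertex \<open>v\<close> of the polytope \<open>conv W\<^sub>k(A)\<close> is the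
  unique maximiser of all directions in some open set \<open>N\<close>, and it is attained at an orthonormal
  family. Inside \<open>N\<close> there is an open set of directions that are maximised by a single vertex of
  \<open>conv W\<^bsub>k-1\<^esub>(A)\<close>; by induction that vertex is attained at joint eigenvectors \<open>y\<close> of the
  operators and their adjoints, and \<open>y\<close> can be completed by one unit vector \<open>x\<close> to a family attaining \<open>v\<close>.
  Perturbing \<open>x\<close> does not increase any of the functionals in \<open>N\<close>, which forces \<open>x\<close> to be a joint
  eigenvector too. The space \<open>M\<close> is the closed span of the joint eigenvectors found for the countably
  many vertices, and \<open>U\<close> is the identity. Convexity of the numerical range of the diagonal part is the
  Schur-Horn theorem for projections: every \<open>p\<close> with entries in \<open>[0, 1]\<close> and integer sum \<open>k\<close> is the
  diagonal of a projection of rank \<open>k\<close>.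
\<close>

section \<open>Complex inner product spaces\<close>

lemma cinner_zero_left [simp]: "cinner 0 (y :: 'a :: complex_inner) = 0"
  using cinner_add_left[of 0 0 y] by simp

lemma cinner_zero_right [simp]: "cinner (x :: 'a :: complex_inner) 0 = 0"
  using cinner_commute[of x 0] by simp

lemma cinner_add_right: "cinner (x :: 'a :: complex_inner) (y + z) = cinner x y + cinner x z"
  by (metis cinner_add_left cinner_commute complex_cnj_add)

lemma cinner_scaleC_right: "cinner (x :: 'a :: complex_inner) (c *\<^sub>C y) = cnj c * cinner x y"
  by (metis cinner_commute cinner_scaleC_left complex_cnj_mult)

lemma cinner_minus_left: "cinner (- x) (y :: 'a :: complex_inner) = - cinner x y"
  using cinner_add_left[of x "- x" y] by (simp add: minus_unique)

lemma cinner_minus_right: "cinner (x :: 'a :: complex_inner) (- y) = - cinner x y"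
  using cinner_add_right[of x y "- y"] by (simp add: minus_unique)

lemma cinner_diff_left: "cinner (x - y) (z :: 'a :: complex_inner) = cinner x z - cinner y z"
  using cinner_add_left[of x "- y" z] by (simp add: cinner_minus_left)

lemma cinner_diff_right: "cinner (x :: 'a :: complex_inner) (y - z) = cinner x y - cinner x z"
  using cinner_add_right[of x y "- z"] by (simp add: cinner_minus_right)

lemma cinner_sum_left: "cinner (\<Sum>i\<in>S. f i) (y :: 'a :: complex_inner) = (\<Sum>i\<in>S. cinner (f i) y)"
  by (induction S rule: infinite_finite_induct) (simp_all add: cinner_add_left)

lemma cinner_sum_right: "cinner (x :: 'a :: complex_inner) (\<Sum>i\<in>S. f i) = (\<Sum>i\<in>S. cinner x (f i))"
  by (induction S rule: infinite_finite_induct) (simp_all add: cinner_add_right)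

lemma cinner_scaleR_left: "cinner (r *\<^sub>R x) (y :: 'a :: complex_inner) = of_real r * cinner x y"
  by (metis cinner_scaleC_left scaleC_of_real)

lemma cinner_scaleR_right: "cinner (x :: 'a :: complex_inner) (r *\<^sub>R y) = of_real r * cinner x y"
  by (metis cinner_scaleC_right complex_cnj_complex_of_real scaleC_of_real)

lemma cinner_self_eq_0 [simp]: "cinner x x = 0 \<longleftrightarrow> x = (0 :: 'a :: complex_inner)"
  by (simp add: cinner_self)

lemma cinner_eq_0_commute: "cinner x y = 0 \<longleftrightarrow> cinner y (x :: 'a :: complex_inner) = 0"
  by (metis cinner_commute complex_cnj_zero_iff)

lemma norm_add_Pythagorean_complex:
  assumes "cinner x (y :: 'a :: complex_inner) = 0"
  shows "(norm (x + y))\<^sup>2 = (norm x)\<^sup>2 + (norm y)\<^sup>2"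
proof -
  have "cinner (x + y) (x + y) = cinner x x + cinner y y"
    using assms cinner_eq_0_commute[of x y] by (simp add: cinner_add_left cinner_add_right del: cinner_self_eq_0)
  then show ?thesis
    unfolding cinner_self using of_real_eq_iff of_real_add by metis
qed

lemma cinner_mult_commute:
  "cinner x y * cinner y (x :: 'a :: complex_inner) = of_real ((cmod (cinner x y))\<^sup>2)"
  by (metis cinner_commute complex_norm_square)

lemma norm_scaleC [simp]: "norm (c *\<^sub>C (x :: 'a :: complex_inner)) = cmod c * norm x"
proof -
  have "complex_of_real ((norm (c *\<^sub>C x))\<^sup>2) = of_real ((cmod c * norm x)\<^sup>2)"
    unfolding cinner_self[symmetric] cinner_scaleC_left cinner_scaleC_right power_mult_distrib
      of_real_mult complex_norm_square[of c] by (simp only: mult_ac)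
  then have "(norm (c *\<^sub>C x))\<^sup>2 = (cmod c * norm x)\<^sup>2"
    using of_real_eq_iff by blast
  then show ?thesis
    by simp
qed

lemma bounded_linear_scaleC: "bounded_linear (\<lambda>x :: 'a :: complex_inner. c *\<^sub>C x)"
  by (rule bounded_linear_intro[where K = "cmod c"])
     (simp_all add: scaleC_add_right scaleC_scaleC mult_ac flip: scaleC_of_real)

text \<open>Expresses the inner product through the norm, so that its continuity is inherited from
  the norm.\<close>

lemma Re_cinner_polarization:
  "Re (cinner x y) = ((norm (x + y))\<^sup>2 - (norm (x - (y :: 'a :: complex_inner)))\<^sup>2) / 4"
proof -
  have 1: "(norm w)\<^sup>2 = Re (cinner w w)" for w :: 'a
    by (simp add: cinner_self)
  have "Re (cinner y x) = Re (cinner x y)"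
    by (metis cinner_commute cnj.sel(1))
  then show ?thesis
    unfolding 1 by (simp add: cinner_add_left cinner_add_right cinner_diff_left cinner_diff_right)
qed

lemma continuous_on_cinner_left: "continuous_on S (\<lambda>x. cinner x (z :: 'a :: complex_inner))"
proof -
  have re: "continuous_on S (\<lambda>x. Re (cinner x w))" for w :: 'a
    unfolding Re_cinner_polarization by (intro continuous_intros) simp_all
  have "Im (cinner x z) = Re (cinner x (\<i> *\<^sub>C z))" for x
    by (simp add: cinner_scaleC_right)
  then have "continuous_on S (\<lambda>x. complex_of_real (Re (cinner x z)) + \<i> * complex_of_real (Im (cinner x z)))"
    using re[of z] re[of "\<i> *\<^sub>C z"] by (auto intro!: continuous_intros)
  then show ?thesis
    by (simp flip: complex_eq)
qed

section \<open>Bounded operators and closed subspaces\<close>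

lemma bounded_clinear_add: "bounded_clinear T \<Longrightarrow> T (x + y) = T x + T y"
  by (simp add: bounded_clinear_def linear_simps)

lemma bounded_clinear_diff: "bounded_clinear T \<Longrightarrow> T (x - y) = T x - T y"
  by (simp add: bounded_clinear_def linear_simps)

lemma bounded_clinear_0: "bounded_clinear T \<Longrightarrow> T 0 = 0"
  by (simp add: bounded_clinear_def linear_simps)

lemma bounded_clinear_scaleC: "bounded_clinear T \<Longrightarrow> T (c *\<^sub>C x) = c *\<^sub>C T x"
  by (simp add: bounded_clinear_def)

lemma bounded_clinear_scaleR: "bounded_clinear T \<Longrightarrow> T (r *\<^sub>R x) = r *\<^sub>R T x"
  by (simp add: bounded_clinear_def linear_simps)

lemma bounded_clinear_sum: "bounded_clinear T \<Longrightarrow> T (\<Sum>i\<in>S. f i) = (\<Sum>i\<in>S. T (f i))"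
  by (induction S rule: infinite_finite_induct) (simp_all add: bounded_clinear_add bounded_clinear_0)

lemma bounded_clinear_id: "bounded_clinear id"
  by (simp add: bounded_clinear_def id_def)

lemma unitary_id: "unitary id"
  by (simp add: unitary_def bounded_clinear_id)

text \<open>The unitary in (c) will be the identity. For the uniqueness behind \<open>THE\<close>,
  \<open>y - S y\<close> is orthogonal to itself.\<close>

lemma cadjoint_id: "cadjoint id = (id :: 'a :: complex_inner \<Rightarrow> 'a)"
  unfolding cadjoint_def
proof (rule the_equality)
  fix S :: "'a \<Rightarrow> 'a"
  assume "\<forall>x y. cinner (id x) y = cinner x (S y)"
  then have "cinner (y - S y) (y - S y) = 0" for y
    by (simp add: cinner_diff_right)
  then show "S = id"
    by (auto simp: fun_eq_iff)
qed simp

lemma csubspace_closure: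
  assumes "csubspace (S :: 'a :: complex_inner set)"
  shows "csubspace (closure S)"
proof (rule complex_vector.subspaceI)
  show "0 \<in> closure S"
    using assms complex_vector.subspace_0 closure_subset by blast
next
  fix x y assume "x \<in> closure S" "y \<in> closure S"
  then obtain f g where "\<forall>n. f n \<in> S" "f \<longlonglongrightarrow> x" "\<forall>n. g n \<in> S" "g \<longlonglongrightarrow> y"
    unfolding closure_sequential by blast
  then have "\<forall>n. f n + g n \<in> S" "(\<lambda>n. f n + g n) \<longlonglongrightarrow> x + y"
    using assms by (auto intro: complex_vector.subspace_add tendsto_add)
  then show "x + y \<in> closure S"
    unfolding closure_sequential by (intro exI[of _ "\<lambda>n. f n + g n"]) blast
next
  fix c x assume "x \<in> closure S"
  moreover have "(*\<^sub>C) c ` closure S \<subseteq> closure S"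
    by (rule image_closure_subset)
       (use assms complex_vector.subspace_scale[OF assms] closure_subset[of S] in
         \<open>auto intro!: linear_continuous_on bounded_linear_scaleC dest: subsetD[OF closure_subset]\<close>)
  ultimately show "c *\<^sub>C x \<in> closure S"
    by blast
qed

lemma csubspace_cinner_left_eq_0: "csubspace {x. cinner x (z :: 'a :: complex_inner) = 0}"
  by (rule complex_vector.subspaceI) (simp_all add: cinner_add_left cinner_scaleC_left)

section \<open>Orthonormal families\<close>

lemma orthonormal_familyD:
  "orthonormal_family I x \<Longrightarrow> i \<in> I \<Longrightarrow> j \<in> I \<Longrightarrow> cinner (x i) (x j) = (if i = j then 1 else 0)"
  by (simp add: orthonormal_family_def)

lemma orthonormal_family_norm:
  assumes "orthonormal_family I x" "i \<in> I"
  shows "norm (x i) = 1"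
proof -
  have "complex_of_real ((norm (x i))\<^sup>2) = of_real 1"
    using orthonormal_familyD[OF assms assms(2)] by (simp only: cinner_self of_real_1 if_True refl)
  then have "(norm (x i))\<^sup>2 = 1"
    using of_real_eq_iff by blast
  then show ?thesis
    by (simp add: power2_eq_1_iff) (smt (verit) norm_ge_zero)
qed

lemma orthonormal_family_mono: "orthonormal_family I x \<Longrightarrow> J \<subseteq> I \<Longrightarrow> orthonormal_family J x"
  unfolding orthonormal_family_def by (meson subsetD)

lemma orthonormal_family_inj_on: "orthonormal_family I x \<Longrightarrow> inj_on x I"
  unfolding orthonormal_family_def inj_on_def by (metis zero_neq_one)

lemma orthonormal_family_update:
  assumes "orthonormal_family (I - {i}) x" "norm z = 1" "\<And>j. j \<in> I \<Longrightarrow> j \<noteq> i \<Longrightarrow> cinner (x j) z = 0"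
  shows "orthonormal_family I (x(i := z))"
  using assms cinner_eq_0_commute[of z] by (auto simp: orthonormal_family_def cinner_self[of z])

lemma orthonormal_family_Suc:
  assumes "orthonormal_family {..<k} x" "norm z = 1" "\<And>j. j < k \<Longrightarrow> cinner (x j) z = 0"
  shows "orthonormal_family {..<Suc k} (x(k := z))"
proof -
  have "{..<Suc k} - {k} = {..<k}" by auto
  then show ?thesis using assms by (intro orthonormal_family_update) auto
qed

text \<open>The vectors that agree with their expansion form a subspace containing every
  \<open>e i\<close>, hence the whole span.\<close>

lemma orthonormal_expansion:
  assumes "finite J" and on: "orthonormal_family J e" and "x \<in> cspan (e ` J)"
  shows "x = (\<Sum>i\<in>J. cinner x (e i) *\<^sub>C e i)"
proof -
  have "csubspace {x. (\<Sum>i\<in>J. cinner x (e i) *\<^sub>C e i) = x}"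
    by (rule complex_vector.subspaceI)
       (simp_all add: cinner_add_left cinner_scaleC_left scaleC_add_left sum.distrib
         scaleC_scaleC[symmetric] complex_vector.scale_sum_right[symmetric]
         del: complex_vector.scale_scale)
  moreover have "e ` J \<subseteq> {x. (\<Sum>i\<in>J. cinner x (e i) *\<^sub>C e i) = x}"
  proof safe
    fix i assume "i \<in> J"
    have "(\<Sum>j\<in>J. cinner (e i) (e j) *\<^sub>C e j) = (\<Sum>j\<in>J. if i = j then e j else 0)"
      by (rule sum.cong) (use on \<open>i \<in> J\<close> in \<open>auto simp: orthonormal_familyD scaleC_one\<close>)
    then show "(\<Sum>j\<in>J. cinner (e i) (e j) *\<^sub>C e j) = e i"
      using assms(1) \<open>i \<in> J\<close> by simp
  qed
  ultimately have "x \<in> {x. (\<Sum>i\<in>J. cinner x (e i) *\<^sub>C e i) = x}"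
    using assms(3) complex_vector.span_minimal by blast
  then show ?thesis
    by (simp only: mem_Collect_eq)
qed

lemma orthonormal_parseval:
  assumes "finite J" "orthonormal_family J e" "x \<in> cspan (e ` J)"
  shows "(\<Sum>i\<in>J. (cmod (cinner x (e i)))\<^sup>2) = (norm x)\<^sup>2"
proof -
  have "cinner x x = cinner (\<Sum>i\<in>J. cinner x (e i) *\<^sub>C e i) x"
    by (rule arg_cong[OF orthonormal_expansion[OF assms]])
  also have "\<dots> = (\<Sum>i\<in>J. cinner x (e i) * cinner (e i) x)"
    by (simp add: cinner_sum_left cinner_scaleC_left)
  also have "\<dots> = of_real (\<Sum>i\<in>J. (cmod (cinner x (e i)))\<^sup>2)"
    by (simp add: cinner_mult_commute)
  finally show ?thesis
    unfolding cinner_self using of_real_eq_iff by metis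
qed

text \<open>\<open>p\<close> is the projection of \<open>x\<close> to the span and
  \<open>x - p\<close> is orthogonal to it, so the bound is Pythagoras together with Parseval for
  \<open>p\<close>.\<close>

lemma orthonormal_bessel:
  assumes J: "finite J" and on: "orthonormal_family J e"
  shows "(\<Sum>i\<in>J. (cmod (cinner (e i) x))\<^sup>2) \<le> (norm x)\<^sup>2"
proof -
  define p where "p = (\<Sum>i\<in>J. cinner x (e i) *\<^sub>C e i)"
  have p: "p \<in> cspan (e ` J)"
    unfolding p_def by (intro complex_vector.span_sum complex_vector.span_scale complex_vector.span_base) auto
  have 1: "cinner p (e i) = cinner x (e i)" if "i \<in> J" for i
  proof -
    have "cinner p (e i) = (\<Sum>j\<in>J. if j = i then cinner x (e j) else 0)"
      unfolding p_def cinner_sum_left cinner_scaleC_left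
      by (rule sum.cong) (use on that in \<open>auto simp: orthonormal_familyD\<close>)
    then show ?thesis using J that by simp
  qed
  have "cinner p (x - p) = (\<Sum>i\<in>J. cinner x (e i) * cinner (e i) (x - p))"
    by (simp add: p_def cinner_sum_left cinner_scaleC_left)
  also have "\<dots> = 0"
    using 1 by (intro sum.neutral) (simp add: cinner_diff_left cinner_eq_0_commute[of "e _" "x - p"])
  finally have 2: "cinner p (x - p) = 0" .
  have "(norm x)\<^sup>2 = (norm p)\<^sup>2 + (norm (x - p))\<^sup>2"
    using norm_add_Pythagorean_complex[OF 2] by simp
  moreover have "(norm p)\<^sup>2 = (\<Sum>i\<in>J. (cmod (cinner (e i) x))\<^sup>2)"
    using orthonormal_parseval[OF J on p] 1
    by (metis (no_types, lifting) cinner_commute complex_mod_cnj sum.cong)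
  ultimately show ?thesis
    by simp
qed

text \<open>
  The new family is the image of the old one under the reflection of its span that maps \<open>x m\<close> to
  \<open>\<omega> *\<^sub>C y\<close>; the phase \<open>\<omega>\<close> makes the inner product of the two real.
\<close>

lemma orthonormal_family_reflect:
  fixes x :: "nat \<Rightarrow> 'a :: complex_inner"
  assumes on: "orthonormal_family {..<k} x" and y: "y \<in> cspan (x ` {..<k})" "norm y = 1"
    and m: "m < k"
  obtains \<omega> z where "orthonormal_family {..<k} z" "z m = \<omega> *\<^sub>C y"
    "\<And>T. bounded_clinear T \<Longrightarrow> (\<Sum>l<k. cinner (T (z l)) (z l)) = (\<Sum>l<k. cinner (T (x l)) (x l))"
proof -
  obtain \<omega> r where \<omega>: "cmod \<omega> = 1" "\<omega> * cinner y (x m) = complex_of_real r"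
  proof (cases "cinner y (x m) = 0")
    case False
    define a where "a = cinner y (x m)"
    show ?thesis
    proof (rule that)
      show "cmod (cnj a / cmod a) = 1"
        using False by (simp add: a_def norm_divide)
      show "cnj a / cmod a * cinner y (x m) = complex_of_real (cmod a)"
        using False complex_norm_square[of a] by (simp add: a_def[symmetric] field_simps power2_eq_square)
    qed
  qed (use that[of 1 0] in auto)
  define w where "w = \<omega> *\<^sub>C y"
  have w: "w \<in> cspan (x ` {..<k})" "cinner w w = 1" "cinner w (x m) = of_real r" "cinner (x m) w = of_real r"
    using y \<omega> cinner_commute[of "x m" w]
    by (simp_all add: w_def complex_vector.span_scale cinner_scaleC_left cinner_self)
  have xm: "cinner (x m) (x m) = 1"
    using on m by (simp add: orthonormal_familyD)
  show ?thesis
  proof (cases "w = x m")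
    case True
    with on that[of x \<omega>] show ?thesis by (simp add: w_def)
  next
    case False
    \<comment> \<open>The reflection in the hyperplane orthogonal to \<open>u\<close> exchanges the
      unit vectors \<open>x m\<close> and \<open>w\<close> because their inner product is
      real.\<close>
    define u where "u = x m - w"
    define t where "t = 2 / (norm u)\<^sup>2"
    have u: "u \<in> cspan (x ` {..<k})" "u \<noteq> 0"
      using w(1) m False by (auto simp: u_def intro: complex_vector.span_diff complex_vector.span_base)
    then have t: "complex_of_real t * cinner u u = 2"
      by (simp add: t_def cinner_self)
    define z where "z l = x l - (of_real t * cinner (x l) u) *\<^sub>C u" for l
    have "cinner (z i) (z j) = cinner (x i) (x j)" for i j
    proof -
      have "cinner (z i) (z j) = cinner (x i) (x j)
         + cinner (x i) u * cinner u (x j) * of_real t * (of_real t * cinner u u - 2)"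
        unfolding z_def by (simp add: cinner_diff_left cinner_diff_right cinner_scaleC_left
            cinner_scaleC_right cinner_commute[of "x j" u] algebra_simps)
      then show ?thesis using t by simp
    qed
    then have 1: "orthonormal_family {..<k} z"
      using on by (simp add: orthonormal_family_def)
    have uu: "cinner u u = 2 - 2 * of_real r" "cinner (x m) u = 1 - of_real r"
      using w xm by (simp_all add: u_def cinner_diff_left cinner_diff_right)
    then have "cinner u u = 2 * cinner (x m) u"
      by simp
    then have "of_real t * cinner (x m) u = 1"
      using t by simp
    then have 2: "z m = \<omega> *\<^sub>C y"
      by (simp add: z_def u_def w_def scaleC_one)
    \<comment> \<open>As \<open>u\<close> lies in the span, expanding it in the \<open>x l\<close>
      evaluates the correction sums to \<open>cinner (T u) u\<close> or \<open>cinner u u\<close>.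
      They cancel because \<open>t\<close> times \<open>cinner u u\<close> is 2.\<close>
    have 3: "(\<Sum>l<k. cinner (T (z l)) (z l)) = (\<Sum>l<k. cinner (T (x l)) (x l))"
      if T: "bounded_clinear T" for T
    proof -
      have "cinner (T (z l)) (z l) = cinner (T (x l)) (x l)
          - of_real t * (cinner (x l) u * cinner (T u) (x l))
          - of_real t * (cinner u (x l) * cinner (T (x l)) u)
          + of_real t * of_real t * cinner (T u) u * (cinner (x l) u * cinner u (x l))" for l
        unfolding z_def
        by (simp add: cinner_diff_left cinner_diff_right cinner_scaleC_left bounded_clinear_diff[OF T]
            bounded_clinear_scaleC[OF T] cinner_scaleC_right cinner_commute[of "x l" u] algebra_simps)
      then have "(\<Sum>l<k. cinner (T (z l)) (z l)) = (\<Sum>l<k. cinner (T (x l)) (x l))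
          - of_real t * (\<Sum>l<k. cinner (x l) u * cinner (T u) (x l))
          - of_real t * (\<Sum>l<k. cinner u (x l) * cinner (T (x l)) u)
          + of_real t * of_real t * cinner (T u) u * (\<Sum>l<k. cinner (x l) u * cinner u (x l))"
        by (simp add: sum.distrib sum_subtractf sum_distrib_left)
      moreover have uexp: "u = (\<Sum>l<k. cinner u (x l) *\<^sub>C x l)"
        by (rule orthonormal_expansion[OF _ on u(1)]) simp
      have "cinner (T u) u = cinner (T u) (\<Sum>l<k. cinner u (x l) *\<^sub>C x l)"
        by (rule arg_cong[OF uexp])
      then have "(\<Sum>l<k. cinner (x l) u * cinner (T u) (x l)) = cinner (T u) u"
        by (simp add: cinner_sum_right cinner_scaleC_right cinner_commute[of "x _" u])
      moreover have "T u = T (\<Sum>l<k. cinner u (x l) *\<^sub>C x l)"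
        by (rule arg_cong[OF uexp])
      then have "T u = (\<Sum>l<k. cinner u (x l) *\<^sub>C T (x l))"
        by (simp add: bounded_clinear_sum[OF T] bounded_clinear_scaleC[OF T])
      then have "(\<Sum>l<k. cinner u (x l) * cinner (T (x l)) u) = cinner (T u) u"
        by (simp add: cinner_sum_left cinner_scaleC_left)
      moreover have "cinner u u = cinner u (\<Sum>l<k. cinner u (x l) *\<^sub>C x l)"
        by (rule arg_cong[OF uexp])
      then have "(\<Sum>l<k. cinner (x l) u * cinner u (x l)) = cinner u u"
        by (simp add: cinner_sum_right cinner_scaleC_right cinner_commute[of "x _" u])
      moreover have "of_real t * of_real t * cinner (T u) u * cinner u u = 2 * of_real t * cinner (T u) u"
        by (simp add: t[symmetric] mult_ac)
      ultimately show ?thesis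
        by simp
    qed
    show ?thesis
      using that[OF 1 2 3] .
  qed
qed

text \<open>Dimension count: the projection \<open>P\<close> onto the span of the \<open>k\<close>
  vectors \<open>y i\<close> cannot be injective on the span of \<open>k + 1\<close> orthonormal
  ones. The normalised kernel vector is \<open>z\<close>.\<close>

lemma nontrivial_combination_orthogonal:
  fixes x y :: "nat \<Rightarrow> 'a :: complex_inner"
  assumes x: "orthonormal_family {..<Suc k} x" and y: "orthonormal_family {..<k} y"
  obtains z where "z \<in> cspan (x ` {..<Suc k})" "norm z = 1" "\<And>i. i < k \<Longrightarrow> cinner z (y i) = 0"
proof -
  define P where "P v = (\<Sum>i<k. cinner v (y i) *\<^sub>C y i)" for v
  have inner_P: "cinner (P v) (y i) = cinner v (y i)" if "i < k" for v i
  proof -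
    have "cinner (P v) (y i) = (\<Sum>j<k. if j = i then cinner v (y j) else 0)"
      unfolding P_def cinner_sum_left cinner_scaleC_left
      by (rule sum.cong) (use y that in \<open>auto simp: orthonormal_familyD\<close>)
    then show ?thesis using that by simp
  qed
  interpret P: Vector_Spaces.linear scaleC scaleC P
    by unfold_locales (simp_all add: P_def cinner_add_left cinner_scaleC_left scaleC_add_left
        sum.distrib complex_vector.scale_sum_right scaleC_scaleC)
  have indep: "complex_vector.independent (x ` {..<Suc k})"
  proof (rule complex_vector.independent_if_scalars_zero)
    fix f v assume f: "(\<Sum>v\<in>x ` {..<Suc k}. f v *\<^sub>C v) = 0" and "v \<in> x ` {..<Suc k}"
    then obtain i where i: "i < Suc k" "v = x i" by auto
    have "0 = cinner (\<Sum>v\<in>x ` {..<Suc k}. f v *\<^sub>C v) (x i)"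
      by (simp add: f)
    also have "\<dots> = (\<Sum>j<Suc k. f (x j) * cinner (x j) (x i))"
      by (simp only: sum.reindex[OF orthonormal_family_inj_on[OF x]] cinner_sum_left cinner_scaleC_left o_def)
    also have "\<dots> = (\<Sum>j<Suc k. if j = i then f (x j) else 0)"
      by (rule sum.cong) (use x i in \<open>auto simp: orthonormal_familyD\<close>)
    also have "\<dots> = f v"
      using i by (simp del: lessThan_Suc sum.lessThan_Suc)
    finally show "f v = 0" by simp
  qed simp
  have "\<exists>z\<in>cspan (x ` {..<Suc k}). z \<noteq> 0 \<and> P z = 0"
  proof (rule ccontr)
    assume "\<not> ?thesis"
    then have inj: "inj_on P (cspan (x ` {..<Suc k}))"
      using P.inj_on_iff_eq_0[folded csubspace_def, OF complex_vector.subspace_span] by blast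
    have "complex_vector.independent (P ` x ` {..<Suc k})"
      by (rule P.independent_injective_image[folded cspan_def, OF indep inj])
    moreover have "P ` x ` {..<Suc k} \<subseteq> cspan (y ` {..<k})"
    proof -
      have "P v \<in> cspan (y ` {..<k})" for v
        unfolding P_def
        by (intro complex_vector.span_sum complex_vector.span_scale complex_vector.span_base imageI)
      then show ?thesis by blast
    qed
    ultimately have "card (P ` x ` {..<Suc k}) \<le> card (y ` {..<k})"
      using complex_vector.independent_span_bound by blast
    moreover have "card (P ` x ` {..<Suc k}) = Suc k"
      using inj_on_subset[OF inj complex_vector.span_superset] orthonormal_family_inj_on[OF x]
      by (metis card_image card_lessThan)
    moreover have "card (y ` {..<k}) \<le> k"
      using card_image_le[of "{..<k}" y] by simp
    ultimately show False
      by simp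
  qed
  then obtain z where z: "z \<in> cspan (x ` {..<Suc k})" "z \<noteq> 0" "P z = 0"
    by blast
  show ?thesis
  proof (rule that[of "complex_of_real (1 / norm z) *\<^sub>C z"])
    show "complex_of_real (1 / norm z) *\<^sub>C z \<in> cspan (x ` {..<Suc k})"
      using z(1) by (rule complex_vector.span_scale)
    show "norm (complex_of_real (1 / norm z) *\<^sub>C z) = 1"
      using z(2) by (simp add: norm_divide)
    show "cinner (complex_of_real (1 / norm z) *\<^sub>C z) (y i) = 0" if "i < k" for i
      using inner_P[OF that, of z] z(3) by (simp add: cinner_scaleC_left)
  qed
qed

section \<open>Exposed points of polytopes\<close>

text \<open>\<open>v\<close> together with the open half-space below it is convex: a proper convex
  combination reaches the level of \<open>v\<close> only if both points are
  \<open>v\<close>.\<close>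

lemma strict_max_convex_hull:
  fixes c :: "'b :: real_inner"
  assumes "\<And>w. w \<in> E \<Longrightarrow> w \<noteq> v \<Longrightarrow> c \<bullet> w < c \<bullet> v" and p: "p \<in> convex hull E" "p \<noteq> v"
  shows "c \<bullet> p < c \<bullet> v"
proof -
  let ?S = "insert v {w. c \<bullet> w < c \<bullet> v}"
  have "convex ?S"
  proof (rule convexI)
    fix x y and a b :: real
    assume xy: "x \<in> ?S" "y \<in> ?S" and ab: "0 \<le> a" "0 \<le> b" "a + b = 1"
    show "a *\<^sub>R x + b *\<^sub>R y \<in> ?S"
    proof (cases "a = 0 \<or> b = 0 \<or> x = v \<and> y = v")
      case True
      then show ?thesis
        using xy ab by (auto simp flip: scaleR_left.add)
    next
      case False
      have le: "c \<bullet> x \<le> c \<bullet> v" "c \<bullet> y \<le> c \<bullet> v"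
        using xy by auto
      have "a * (c \<bullet> x) + b * (c \<bullet> y) < a * (c \<bullet> v) + b * (c \<bullet> v)"
      proof (cases "x = v")
        case True
        with False xy ab show ?thesis by (auto intro: mult_strict_left_mono)
      next
        case False
        with \<open>\<not> (a = 0 \<or> b = 0 \<or> x = v \<and> y = v)\<close> xy ab le show ?thesis
          by (intro add_less_le_mono mult_strict_left_mono mult_left_mono) auto
      qed
      also have "\<dots> = c \<bullet> v"
        using ab by (simp flip: distrib_right)
      finally show ?thesis
        by (simp add: inner_add_right)
    qed
  qed
  moreover have "E \<subseteq> ?S"
    using assms(1) by blast
  ultimately show ?thesis
    using p hull_minimal[of E ?S convex] by blast
qed

text \<open>A vertex is a face, and the faces of a polyhedron are exposed; \<open>c\<close> is the
  normal of the supporting hyperplane.\<close>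

lemma polytope_extreme_point_exposed:
  fixes P :: "'b :: euclidean_space set"
  assumes "polytope P" "v extreme_point_of P"
  obtains c where "\<And>w. w \<in> P \<Longrightarrow> w \<noteq> v \<Longrightarrow> c \<bullet> w < c \<bullet> v"
proof -
  have "{v} exposed_face_of P"
    using assms(2) exposed_face_of_polyhedron[OF polytope_imp_polyhedron[OF assms(1)]]
    by (simp add: face_of_singleton)
  then obtain a b where ab: "P \<subseteq> {x. a \<bullet> x \<le> b}" "{v} = P \<inter> {x. a \<bullet> x = b}"
    unfolding exposed_face_of by blast
  have "a \<bullet> w < a \<bullet> v" if "w \<in> P" "w \<noteq> v" for w
  proof -
    have "a \<bullet> v = b" "a \<bullet> w \<noteq> b" "a \<bullet> w \<le> b"
      using ab that by auto
    then show ?thesis by linarith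
  qed
  then show ?thesis
    using that by blast
qed

text \<open>Finitely many strict inequalities, each continuous in \<open>c\<close>.\<close>

lemma open_exposing_directions:
  fixes E :: "'b :: real_inner set"
  assumes "finite E" "open N"
  shows "open {c \<in> N. \<forall>w\<in>E. w \<noteq> v \<longrightarrow> c \<bullet> w < c \<bullet> v}"
proof -
  have "{c \<in> N. \<forall>w\<in>E. w \<noteq> v \<longrightarrow> c \<bullet> w < c \<bullet> v} = N \<inter> (\<Inter>w\<in>E - {v}. {c. c \<bullet> w < c \<bullet> v})"
    by auto
  also have "open \<dots>"
    using assms by (intro open_Int open_INT ballI open_Collect_less continuous_intros) auto
  finally show ?thesis .
qed

text \<open>
  Among the maximisers of a given direction \<open>c\<close>, one of largest norm, \<open>v\<close>, is the only
  maximiser of \<open>c + \<epsilon> v\<close> for small \<open>\<epsilon> > 0\<close>.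
\<close>

lemma generic_direction:
  fixes E :: "'b :: real_inner set"
  assumes E: "finite E" "E \<noteq> {}" and N: "open N" "N \<noteq> {}"
  obtains c v where "c \<in> N" "v \<in> E" "\<And>w. w \<in> E \<Longrightarrow> w \<noteq> v \<Longrightarrow> c \<bullet> w < c \<bullet> v"
proof -
  obtain c where c: "c \<in> N" using N by auto
  define T where "T = {w \<in> E. \<forall>w'\<in>E. c \<bullet> w' \<le> c \<bullet> w}"
  have max: "\<exists>w\<in>S. \<forall>w'\<in>S. f w' \<le> f w" if "finite S" "S \<noteq> {}" for S and f :: "'b \<Rightarrow> real"
    using obtains_MAX[OF that, of f] that by (metis Max_ge finite_imageI imageI)
  have T: "finite T" "T \<noteq> {}"
    using E max[OF E] by (auto simp: T_def)
  obtain v where v: "v \<in> T" "\<And>w. w \<in> T \<Longrightarrow> norm w \<le> norm v"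
    using max[OF T] by metis
  have 1: "\<forall>\<^sub>F \<epsilon> in at_right 0. (c + \<epsilon> *\<^sub>R v) \<bullet> w < (c + \<epsilon> *\<^sub>R v) \<bullet> v" if w: "w \<in> E - {v}" for w
  proof (cases "w \<in> T")
    case True
    then have "c \<bullet> w = c \<bullet> v"
      using v(1) by (intro antisym) (auto simp: T_def)
    \<comment> \<open>A tie for \<open>c\<close> is broken by \<open>v\<close>: expanding the square
      and using \<open>norm w \<le> norm v\<close> gives
      \<open>v \<bullet> w < v \<bullet> v\<close>.\<close>
    have "0 < (v - w) \<bullet> (v - w)"
      using w by auto
    then have "v \<bullet> w < v \<bullet> v"
      using v(2)[OF True] by (simp add: norm_le inner_diff_left inner_diff_right inner_commute)
    with \<open>c \<bullet> w = c \<bullet> v\<close> show ?thesis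
      by (auto simp: inner_add_left eventually_at_right_less intro: eventually_mono[OF eventually_at_right_less[of 0]])
  next
    case False
    then have "c \<bullet> w < c \<bullet> v"
      using v(1) w unfolding T_def by force
    moreover have "((\<lambda>\<epsilon>. (c + \<epsilon> *\<^sub>R v) \<bullet> v - (c + \<epsilon> *\<^sub>R v) \<bullet> w) \<longlongrightarrow> (c + 0 *\<^sub>R v) \<bullet> v - (c + 0 *\<^sub>R v) \<bullet> w) (at_right 0)"
      by (intro tendsto_intros)
    ultimately have "\<forall>\<^sub>F \<epsilon> in at_right 0. 0 < (c + \<epsilon> *\<^sub>R v) \<bullet> v - (c + \<epsilon> *\<^sub>R v) \<bullet> w"
      by (intro order_tendstoD(1)) auto
    then show ?thesis
      by eventually_elim simp
  qed
  have "((\<lambda>\<epsilon>. c + \<epsilon> *\<^sub>R v) \<longlongrightarrow> c + 0 *\<^sub>R v) (at_right 0)"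
    by (intro tendsto_intros)
  then have 2: "\<forall>\<^sub>F \<epsilon> in at_right 0. c + \<epsilon> *\<^sub>R v \<in> N"
    using topological_tendstoD[OF _ N(1)] c by simp
  have "\<forall>\<^sub>F \<epsilon> in at_right (0::real). c + \<epsilon> *\<^sub>R v \<in> N \<and>
      (\<forall>w\<in>E - {v}. (c + \<epsilon> *\<^sub>R v) \<bullet> w < (c + \<epsilon> *\<^sub>R v) \<bullet> v)"
    using 1 2 E by (intro eventually_conj eventually_ball_finite) auto
  then obtain \<epsilon> :: real where "c + \<epsilon> *\<^sub>R v \<in> N" "\<forall>w\<in>E - {v}. (c + \<epsilon> *\<^sub>R v) \<bullet> w < (c + \<epsilon> *\<^sub>R v) \<bullet> v"
    using eventually_happens'[OF trivial_limit_at_right_real] by blast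
  with v(1) show ?thesis
    using that[of "c + \<epsilon> *\<^sub>R v" v] by (auto simp: T_def)
qed

lemma polytope_finite_extreme_points:
  "polytope P \<Longrightarrow> finite {v. v extreme_point_of (P :: 'b :: euclidean_space set)}"
  using finite_polyhedron_extreme_points polytope_imp_polyhedron by blast

lemma polytope_eq_convex_hull_extreme_points:
  "polytope P \<Longrightarrow> P = convex hull {v. v extreme_point_of (P :: 'b :: euclidean_space set)}"
  by (intro Krein_Milman_Minkowski polytope_imp_compact polytope_imp_convex)

section \<open>The quadratic map behind the numerical range and its first variation\<close>

definition joint_form :: "('m \<Rightarrow> 'a :: complex_inner \<Rightarrow> 'a) \<Rightarrow> 'a \<Rightarrow> complex ^ 'm" where
  "joint_form A x = (\<chi> j. cinner (A j x) x)"

lemma joint_form_scaleR: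
  assumes "\<And>j. bounded_clinear (A j)"
  shows "joint_form A (r *\<^sub>R x) = r\<^sup>2 *\<^sub>R joint_form A x"
  unfolding vec_eq_iff vector_scaleR_component
  unfolding scaleR_conv_of_real
  by (simp add: joint_form_def bounded_clinear_scaleR[OF assms] cinner_scaleR_left cinner_scaleR_right
      power2_eq_square)

lemma joint_form_add_scaleR:
  assumes "\<And>j. bounded_clinear (A j)"
  shows "joint_form A (x + s *\<^sub>R y) =
    joint_form A x + s *\<^sub>R (\<chi> j. cinner (A j x) y + cinner (A j y) x) + s\<^sup>2 *\<^sub>R joint_form A y"
  unfolding vec_eq_iff vector_scaleR_component vector_add_component
  unfolding scaleR_conv_of_real
  by (simp add: joint_form_def bounded_clinear_scaleR[OF assms] bounded_clinear_add[OF assms]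
      cinner_scaleR_left cinner_scaleR_right cinner_add_left cinner_add_right power2_eq_square
      algebra_simps)

lemma joint_numrange_on_eq:
  "joint_numrange_on M k A =
    {\<Sum>l<k. joint_form A (x l) | x. orthonormal_family {..<k} x \<and> x ` {..<k} \<subseteq> M}"
proof -
  have "(\<chi> j. \<Sum>l<k. cinner (A j (x l)) (x l)) = (\<Sum>l<k. joint_form A (x l))" for x
    by (simp add: vec_eq_iff joint_form_def)
  then show ?thesis
    unfolding joint_numrange_on_def by simp
qed

lemma joint_form_in_numrange:
  "orthonormal_family {..<k} x \<Longrightarrow> (\<Sum>l<k. joint_form A (x l)) \<in> joint_numrange k A"
  unfolding joint_numrange_on_eq by blast

text \<open>First-order condition at a maximum: near \<open>0\<close> a quadratic term is too small
  to dominate a linear term of either sign. The \<open>+ 1\<close> in \<open>g\<close> keeps the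
  test point \<open>\<beta> / g\<close> defined when \<open>\<gamma> = 0\<close>.\<close>

lemma real_linear_le_quadratic_imp_0:
  fixes \<beta> \<gamma> :: real
  assumes "\<And>s. s * \<beta> \<le> s\<^sup>2 * \<gamma>"
  shows "\<beta> = 0"
proof -
  define g where "g = \<bar>\<gamma>\<bar> + 1"
  have g: "g > 0" "\<gamma> < g" by (auto simp: g_def)
  have "\<beta> / g * \<beta> \<le> (\<beta> / g)\<^sup>2 * \<gamma>" by (rule assms)
  then have "\<beta>\<^sup>2 * g \<le> \<beta>\<^sup>2 * \<gamma>"
    using g by (simp add: power2_eq_square field_simps)
  then have "\<beta>\<^sup>2 * (g - \<gamma>) \<le> 0"
    by (simp add: algebra_simps)
  then have "\<beta>\<^sup>2 \<le> 0"
    using g by (simp add: mult_le_0_iff)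
  then show ?thesis by simp
qed

text \<open>A hyperplane has empty interior.\<close>

lemma inner_eq_0_on_open_imp_0:
  fixes B :: "'b :: euclidean_space"
  assumes "open N" "N \<noteq> {}" "\<And>c. c \<in> N \<Longrightarrow> c \<bullet> B = 0"
  shows "B = 0"
proof (rule ccontr)
  assume "B \<noteq> 0"
  then have "interior {c. B \<bullet> c = 0} = {}"
    by (rule interior_hyperplane)
  moreover have "N \<subseteq> interior {c. B \<bullet> c = 0}"
    using assms by (intro interior_maximal) (auto simp: inner_commute)
  ultimately show False
    using assms(2) by blast
qed

text \<open>The last vector of a maximiser is varied. Stationarity for every
  \<open>c \<in> N\<close> kills the whole derivative vector, as \<open>N\<close> is open;
  variations along \<open>u\<close> and along \<open>\<i> *\<^sub>C u\<close> then separate the two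
  inner products.\<close>

lemma maximiser_orthogonality:
  fixes A :: "'m :: finite \<Rightarrow> 'a :: complex_inner \<Rightarrow> 'a"
  assumes lin: "\<And>j. bounded_clinear (A j)"
    and on: "orthonormal_family {..<Suc k} w"
    and N: "open N" "N \<noteq> {}"
    and max: "\<And>c p. c \<in> N \<Longrightarrow> p \<in> joint_numrange (Suc k) A \<Longrightarrow> c \<bullet> p \<le> c \<bullet> (\<Sum>l<Suc k. joint_form A (w l))"
    and u: "\<And>l. l < Suc k \<Longrightarrow> cinner (w l) u = 0"
  shows "cinner (A j (w k)) u = 0" "cinner (A j u) (w k) = 0"
proof -
  let ?x = "w k"
  have nx: "norm ?x = 1"
    using orthonormal_family_norm[OF on] by simp
  have var: "cinner (A j ?x) y + cinner (A j y) ?x = 0"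
    if y: "\<And>l. l < Suc k \<Longrightarrow> cinner (w l) y = 0" for y j
  proof -
    define B :: "complex ^ 'm" where "B = (\<chi> j. cinner (A j ?x) y + cinner (A j y) ?x)"
    have "c \<bullet> B = 0" if c: "c \<in> N" for c
    proof (rule real_linear_le_quadratic_imp_0)
      fix s :: real
      let ?v = "?x + s *\<^sub>R y"
      \<comment> \<open>After normalisation the family is again orthonormal, since \<open>y\<close>
        is orthogonal to all its members; \<open>n\<close> is found by Pythagoras.\<close>
      define n where "n = norm ?v"
      have n2: "n\<^sup>2 = 1 + s\<^sup>2 * (norm y)\<^sup>2"
        using y[of k] nx norm_add_Pythagorean_complex[of ?x "s *\<^sub>R y"]
        by (simp add: n_def cinner_scaleR_right power_mult_distrib)
      then have "n\<^sup>2 > 0"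
        by (smt (verit) mult_nonneg_nonneg zero_le_power2)
      then have n: "n > 0"
        by (simp add: n_def)
      let ?z = "(1 / n) *\<^sub>R ?v"
      have "orthonormal_family {..<Suc k} (w(k := ?z))"
      proof (rule orthonormal_family_Suc)
        show "orthonormal_family {..<k} w"
          using on by (rule orthonormal_family_mono) auto
        show "norm ?z = 1"
          using n by (simp add: n_def)
        show "cinner (w l) ?z = 0" if "l < k" for l
          using that y[of l] orthonormal_familyD[OF on, of l k]
          by (simp add: cinner_scaleR_right cinner_add_right)
      qed
      from max[OF c joint_form_in_numrange[OF this]]
      have "c \<bullet> joint_form A ?z \<le> c \<bullet> joint_form A ?x"
        by (simp add: inner_add_right)
      moreover have "joint_form A ?z = (1 / n\<^sup>2) *\<^sub>R (joint_form A ?x + s *\<^sub>R B + s\<^sup>2 *\<^sub>R joint_form A y)"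
        unfolding joint_form_scaleR[of A, OF lin] joint_form_add_scaleR[of A, OF lin]
        by (simp add: B_def power_one_over)
      ultimately have "c \<bullet> joint_form A ?x + s * (c \<bullet> B) + s\<^sup>2 * (c \<bullet> joint_form A y) \<le> n\<^sup>2 * (c \<bullet> joint_form A ?x)"
        using n by (simp add: inner_add_right field_simps)
      then show "s * (c \<bullet> B) \<le> s\<^sup>2 * ((norm y)\<^sup>2 * (c \<bullet> joint_form A ?x) - c \<bullet> joint_form A y)"
        unfolding n2 by (simp add: algebra_simps)
    qed
    then have "B = 0"
      using inner_eq_0_on_open_imp_0 N by blast
    then show ?thesis
      by (simp add: B_def vec_eq_iff)
  qed
  have 1: "cinner (A j ?x) u + cinner (A j u) ?x = 0"
    using u by (rule var)
  have "cinner (A j ?x) (\<i> *\<^sub>C u) + cinner (A j (\<i> *\<^sub>C u)) ?x = 0"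
    using u by (intro var) (simp add: cinner_scaleC_right)
  then have "\<i> * (cinner (A j u) ?x - cinner (A j ?x) u) = 0"
    by (simp add: cinner_scaleC_right cinner_scaleC_left bounded_clinear_scaleC[OF lin] algebra_simps)
  then have "cinner (A j u) ?x = cinner (A j ?x) u"
    by simp
  with 1 show "cinner (A j ?x) u = 0" "cinner (A j u) ?x = 0"
    by simp_all
qed

section \<open>Vertices and joint eigenvectors\<close>

text \<open>
  The second conjunct says that \<open>x\<close> is an eigenvector of the adjoint of \<open>A j\<close> for the
  conjugate eigenvalue, so that the line spanned by \<open>x\<close> reduces every \<open>A j\<close>.
\<close>

definition joint_eigenvector :: "('m \<Rightarrow> 'a :: complex_inner \<Rightarrow> 'a) \<Rightarrow> ('m \<Rightarrow> complex) \<Rightarrow> 'a \<Rightarrow> bool" where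
  "joint_eigenvector A a x \<longleftrightarrow> (\<forall>j. A j x = a j *\<^sub>C x \<and> (\<forall>y. cinner (A j y) x = a j * cinner y x))"

text \<open>
  If \<open>y\<close> spans a maximiser for \<open>k\<close> and \<open>z\<close> one for \<open>k + 1\<close>, rotated so that \<open>z k\<close> is orthogonal
  to \<open>y\<close>, then \<open>y\<close> together with \<open>z k\<close> is a maximiser for \<open>k + 1\<close> as well.
\<close>

lemma exposed_point_joint_eigenvectors:
  fixes A :: "'m :: finite \<Rightarrow> 'a :: complex_inner \<Rightarrow> 'a"
  assumes lin: "\<And>j. bounded_clinear (A j)"
    and "\<And>i. 0 < i \<Longrightarrow> i < k \<Longrightarrow> polytope (convex hull (joint_numrange i A))"
    and "open N" "N \<noteq> {}" "v \<in> joint_numrange k A"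
    and "\<And>c p. c \<in> N \<Longrightarrow> p \<in> joint_numrange k A \<Longrightarrow> p \<noteq> v \<Longrightarrow> c \<bullet> p < c \<bullet> v"
  shows "\<exists>x. orthonormal_family {..<k} x \<and> v = (\<Sum>l<k. joint_form A (x l)) \<and>
    (\<forall>l<k. \<exists>a. joint_eigenvector A a (x l))"
  using assms(2-)
proof (induction k arbitrary: v N)
  case 0
  then show ?case
    by (auto simp: joint_numrange_on_eq orthonormal_family_def)
next
  case (Suc k)
  note max = \<open>\<And>c p. c \<in> N \<Longrightarrow> p \<in> joint_numrange (Suc k) A \<Longrightarrow> p \<noteq> v \<Longrightarrow> c \<bullet> p < c \<bullet> v\<close>
  obtain x where x: "orthonormal_family {..<Suc k} x" and v: "v = (\<Sum>l<Suc k. joint_form A (x l))"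
    using Suc.prems(4) unfolding joint_numrange_on_eq by blast
  define W where "W = joint_numrange k A"
  define E where "E = {e. e extreme_point_of (convex hull W)}"
  have "W \<noteq> {}"
    using orthonormal_family_mono[OF x, of "{..<k}"] joint_form_in_numrange[of k x A] by (auto simp: W_def)
  have poly: "polytope (convex hull W)"
  \<comment> \<open>The hypothesis starts at 1; for \<open>k = 0\<close> the empty sum is the only
    point.\<close>
  proof (cases "k = 0")
    case True
    have "W = {0}"
      using True by (auto simp: W_def joint_numrange_on_eq orthonormal_family_def)
    then show ?thesis
      by (simp add: polytope_sing)
  next
    case False
    then show ?thesis
      using Suc.prems(1)[of k] by (simp add: W_def)
  qed
  note E = polytope_finite_extreme_points[OF poly, folded E_def]
    polytope_eq_convex_hull_extreme_points[OF poly, folded E_def]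
  have "E \<noteq> {}"
    using E(2) \<open>W \<noteq> {}\<close> by auto
  then obtain c v' where c: "c \<in> N" and v': "v' \<in> E" "\<And>w. w \<in> E \<Longrightarrow> w \<noteq> v' \<Longrightarrow> c \<bullet> w < c \<bullet> v'"
    using generic_direction[OF E(1) _ Suc.prems(2,3)] by blast
  \<comment> \<open>An open set of directions in which \<open>v'\<close> alone is maximal, as the
    induction hypothesis requires.\<close>
  define N' where "N' = {c \<in> N. \<forall>w\<in>E. w \<noteq> v' \<longrightarrow> c \<bullet> w < c \<bullet> v'}"
  have N': "open N'" "c \<in> N'"
    using open_exposing_directions[OF E(1) Suc.prems(2), of v'] c v' by (auto simp: N'_def)
  have max': "d \<bullet> p < d \<bullet> v'" if "d \<in> N'" "p \<in> W" "p \<noteq> v'" for d p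
  proof (rule strict_max_convex_hull)
    show "p \<in> convex hull E"
      using that(2) E(2) hull_inc by metis
  qed (use that in \<open>auto simp: N'_def\<close>)
  have "v' \<in> W"
    using v'(1) extreme_point_of_convex_hull unfolding E_def by blast
  then obtain y where y: "orthonormal_family {..<k} y" and v'y: "v' = (\<Sum>l<k. joint_form A (y l))"
    and eig: "\<forall>l<k. \<exists>a. joint_eigenvector A a (y l)"
    using Suc.IH[of N' v'] Suc.prems(1) N' max' unfolding W_def by fastforce
  \<comment> \<open>The span of \<open>x\<close> contains a unit vector orthogonal to all
    \<open>y i\<close>; the reflection then puts the last vector in its direction without changing
    the traces.\<close>
  obtain t where t: "t \<in> cspan (x ` {..<Suc k})" "norm t = 1" "\<And>i. i < k \<Longrightarrow> cinner t (y i) = 0"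
    using nontrivial_combination_orthogonal[OF x y] by blast
  obtain \<omega> z where z: "orthonormal_family {..<Suc k} z" "z k = \<omega> *\<^sub>C t"
    and trace: "\<And>T. bounded_clinear T \<Longrightarrow> (\<Sum>l<Suc k. cinner (T (z l)) (z l)) = (\<Sum>l<Suc k. cinner (T (x l)) (x l))"
    using orthonormal_family_reflect[OF x t(1,2), of k] by (metis lessI)
  have vz: "v = (\<Sum>l<Suc k. joint_form A (z l))"
    using trace[OF lin] v by (simp add: vec_eq_iff joint_form_def)
  have y_z: "cinner (y l) (z k) = 0" if "l < k" for l
    using t(3)[OF that] cinner_eq_0_commute[of t "y l"] by (simp add: z(2) cinner_scaleC_right)
  define w where "w = y(k := z k)"
  have w: "orthonormal_family {..<Suc k} w"
    unfolding w_def using y y_z orthonormal_family_norm[OF z(1), of k] by (intro orthonormal_family_Suc) auto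
  have wsum: "(\<Sum>l<Suc k. joint_form A (w l)) = v' + joint_form A (z k)"
    by (simp add: w_def v'y)
  \<comment> \<open>The first \<open>k\<close> vectors of \<open>z\<close> compete with
    \<open>v'\<close>, so exchanging them for \<open>y\<close> does not lower the value in direction
    \<open>c\<close>. Uniqueness of the maximiser \<open>v\<close> then gives equality.\<close>
  have "(\<Sum>l<k. joint_form A (z l)) \<in> W"
    unfolding W_def by (intro joint_form_in_numrange orthonormal_family_mono[OF z(1)]) auto
  then have "c \<bullet> (\<Sum>l<k. joint_form A (z l)) \<le> c \<bullet> v'"
    using max'[OF N'(2)] by (cases "(\<Sum>l<k. joint_form A (z l)) = v'") (auto intro: less_imp_le)
  then have "c \<bullet> v \<le> c \<bullet> (\<Sum>l<Suc k. joint_form A (w l))"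
    unfolding wsum vz by (simp add: inner_add_right)
  then have vw: "v = (\<Sum>l<Suc k. joint_form A (w l))"
    using max[OF c joint_form_in_numrange[OF w]] by force
  have orth: "cinner (A j (z k)) u = 0 \<and> cinner (A j u) (z k) = 0"
    if "\<And>l. l < Suc k \<Longrightarrow> cinner (w l) u = 0" for j u
  proof -
    have "d \<bullet> p \<le> d \<bullet> (\<Sum>l<Suc k. joint_form A (w l))" if "d \<in> N" "p \<in> joint_numrange (Suc k) A" for d p
      using max[OF that] unfolding vw[symmetric] by (cases "p = v") auto
    from maximiser_orthogonality[OF lin w Suc.prems(2,3) this that]
    show ?thesis
      by (simp add: w_def)
  qed
  define a where "a j = cinner (A j (z k)) (z k)" for j
  have zk: "cinner (z k) (z k) = 1"
    using orthonormal_familyD[OF z(1), of k k] by simp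
  have "joint_eigenvector A a (z k)"
    unfolding joint_eigenvector_def
  proof (intro allI conjI)
    fix j
    define r where "r = A j (z k) - a j *\<^sub>C z k"
    \<comment> \<open>Orthogonal to \<open>w k\<close> by the choice of \<open>a\<close>, and to
      \<open>y l\<close> because \<open>y l\<close> is an eigenvector of the adjoint as well. Hence
      \<open>orth\<close> applies to \<open>r\<close> itself and yields
      \<open>cinner r r = 0\<close>.\<close>
    have wr: "cinner (w l) r = 0" if "l < Suc k" for l
    proof (cases "l = k")
      case True
      then have "cinner r (w l) = 0"
        using zk by (simp add: r_def w_def a_def cinner_diff_left cinner_scaleC_left)
      then show ?thesis
        using cinner_eq_0_commute by blast
    next
      case False
      with that have l: "l < k" by simp
      with eig obtain b where "joint_eigenvector A b (y l)" by blast
      then have "cinner r (y l) = 0"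
        using y_z[OF l] cinner_eq_0_commute[of "y l" "z k"]
        by (simp add: r_def joint_eigenvector_def cinner_diff_left cinner_scaleC_left)
      then show ?thesis
        using False cinner_eq_0_commute[of r "y l"] by (simp add: w_def)
    qed
    have "cinner r r = cinner (A j (z k)) r - a j * cinner (z k) r"
      by (simp add: r_def cinner_diff_left cinner_scaleC_left)
    also have "\<dots> = 0"
      using orth[OF wr] wr[of k] by (simp add: w_def)
    finally show "A j (z k) = a j *\<^sub>C z k"
      by (simp add: r_def)
  next
    fix j u
    \<comment> \<open>\<open>orth\<close> handles the rest \<open>u - p\<close> of the projection.
      Within \<open>p\<close>, each \<open>A j (y l)\<close> is a multiple of \<open>y l\<close> and
      so orthogonal to \<open>z k\<close>.\<close>
    define p where "p = (\<Sum>l<Suc k. cinner u (w l) *\<^sub>C w l)"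
    have wp: "cinner (w l) (u - p) = 0" if "l < Suc k" for l
    proof -
      have "cinner p (w l) = (\<Sum>i<Suc k. if i = l then cinner u (w i) else 0)"
        unfolding p_def cinner_sum_left cinner_scaleC_left
        by (rule sum.cong) (use that orthonormal_familyD[OF w, of _ l] in auto)
      also have "\<dots> = cinner u (w l)"
        using that by (simp del: sum.lessThan_Suc)
      finally have "cinner (u - p) (w l) = 0"
        by (simp add: cinner_diff_left)
      then show ?thesis
        using cinner_eq_0_commute by blast
    qed
    have "cinner (A j (y l)) (z k) = 0" if l: "l < k" for l
    proof -
      from eig l obtain b where "joint_eigenvector A b (y l)" by blast
      then show ?thesis
        using y_z[OF l] by (simp add: joint_eigenvector_def cinner_scaleC_left)
    qed
    then have "cinner (A j p) (z k) = cinner u (z k) * a j"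
      unfolding p_def
      by (simp add: bounded_clinear_sum[OF lin] bounded_clinear_add[OF lin] bounded_clinear_scaleC[OF lin]
          cinner_sum_left cinner_add_left cinner_scaleC_left w_def a_def)
    moreover have "cinner (A j u) (z k) = cinner (A j p) (z k)"
      using orth[OF wp, of j] by (simp add: bounded_clinear_diff[OF lin] cinner_diff_left)
    ultimately show "cinner (A j u) (z k) = a j * cinner u (z k)"
      by simp
  qed
  then have "\<forall>l<Suc k. \<exists>a. joint_eigenvector A a (w l)"
    using eig by (auto simp: w_def less_Suc_eq)
  with w vw show ?case
    by blast
qed

text \<open>Supplies the open set of directions: a vertex is exposed in some direction, and
  finiteness of the vertex set makes this an open condition.\<close>

lemma polytope_extreme_point_joint_eigenvectors:
  fixes A :: "'m :: finite \<Rightarrow> 'a :: complex_inner \<Rightarrow> 'a"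
  assumes lin: "\<And>j. bounded_clinear (A j)"
    and poly: "\<And>i. 0 < i \<Longrightarrow> i \<le> k \<Longrightarrow> polytope (convex hull (joint_numrange i A))"
    and k: "0 < k" and v: "v extreme_point_of (convex hull (joint_numrange k A))"
  obtains x where "orthonormal_family {..<k} x" "v = (\<Sum>l<k. joint_form A (x l))"
    "\<And>l. l < k \<Longrightarrow> \<exists>a. joint_eigenvector A a (x l)"
proof -
  let ?P = "convex hull (joint_numrange k A)"
  define E where "E = {e. e extreme_point_of ?P}"
  have P: "polytope ?P"
    using poly k by blast
  note E = polytope_finite_extreme_points[OF P, folded E_def]
    polytope_eq_convex_hull_extreme_points[OF P, folded E_def]
  obtain c where c: "\<And>w. w \<in> ?P \<Longrightarrow> w \<noteq> v \<Longrightarrow> c \<bullet> w < c \<bullet> v"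
    using polytope_extreme_point_exposed[OF P v] by blast
  define N where "N = {c \<in> UNIV. \<forall>w\<in>E. w \<noteq> v \<longrightarrow> c \<bullet> w < c \<bullet> v}"
  have "open N"
    unfolding N_def by (rule open_exposing_directions[OF E(1) open_UNIV])
  moreover have "c \<in> N"
    using c by (auto simp: N_def E_def extreme_point_of_def)
  \<comment> \<open>A vertex of a hull lies in the generating set, so it is attained at an
    orthonormal family without any closedness of the numerical range.\<close>
  moreover have "v \<in> joint_numrange k A"
    using extreme_point_of_convex_hull v by blast
  moreover have "d \<bullet> p < d \<bullet> v" if "d \<in> N" "p \<in> joint_numrange k A" "p \<noteq> v" for d p
  proof (rule strict_max_convex_hull)
    show "p \<in> convex hull E"
      using that(2) E(2) hull_inc by metis
  qed (use that in \<open>auto simp: N_def\<close>)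
  ultimately have "\<exists>x. orthonormal_family {..<k} x \<and> v = (\<Sum>l<k. joint_form A (x l)) \<and>
    (\<forall>l<k. \<exists>a. joint_eigenvector A a (x l))"
    using poly by (intro exposed_point_joint_eigenvectors[of A k N v, OF lin]) auto
  then show ?thesis
    using that by blast
qed

section \<open>Gram-Schmidt and prescribed diagonals\<close>

text \<open>The vector produced is \<open>0\<close> when \<open>u n\<close> depends linearly on its predecessors, as \<open>1 / 0 = 0\<close>.\<close>

fun gram_schmidt :: "(nat \<Rightarrow> 'a :: complex_inner) \<Rightarrow> nat \<Rightarrow> 'a" where
  "gram_schmidt u n = (let r = u n - (\<Sum>i<n. cinner (u n) (gram_schmidt u i) *\<^sub>C gram_schmidt u i)
     in (1 / norm r) *\<^sub>R r)"

declare gram_schmidt.simps [simp del]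

lemma gram_schmidt_norm: "gram_schmidt u n \<noteq> 0 \<Longrightarrow> norm (gram_schmidt u n) = 1"
  by (subst gram_schmidt.simps, subst (asm) gram_schmidt.simps) (simp add: Let_def)

text \<open>Subtracting the projections removes the component along each earlier vector; an earlier
  vector that is \<open>0\<close> is orthogonal to everything.\<close>

lemma gram_schmidt_orthogonal: "i < n \<Longrightarrow> cinner (gram_schmidt u n) (gram_schmidt u i) = 0"
proof (induction n arbitrary: i rule: less_induct)
  case (less n)
  let ?e = "gram_schmidt u"
  define r where "r = u n - (\<Sum>i<n. cinner (u n) (?e i) *\<^sub>C ?e i)"
  have orth: "cinner (?e j) (?e i) = 0" if "j < n" "j \<noteq> i" for j
    using less.IH[of j i] less.IH[of i j] less.prems that cinner_eq_0_commute[of "?e i" "?e j"] by fastforce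
  have "(\<Sum>j<n. cinner (u n) (?e j) * cinner (?e j) (?e i)) =
      (\<Sum>j<n. if j = i then cinner (u n) (?e i) * cinner (?e i) (?e i) else 0)"
    using orth by (intro sum.cong) auto
  also have "\<dots> = cinner (u n) (?e i) * cinner (?e i) (?e i)"
    using less.prems by simp
  also have "\<dots> = cinner (u n) (?e i)"
    using gram_schmidt_norm[of u i] by (cases "?e i = 0") (simp_all add: cinner_self)
  finally have "cinner r (?e i) = 0"
    by (simp add: r_def cinner_diff_left cinner_sum_left cinner_scaleC_left)
  then show ?case
    by (subst gram_schmidt.simps) (simp add: r_def[symmetric] cinner_scaleR_left)
qed

lemma gram_schmidt_orthonormal:
  "orthonormal_family {n. gram_schmidt u n \<noteq> 0} (gram_schmidt u)"
  unfolding orthonormal_family_def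
proof (intro ballI)
  fix i j assume "i \<in> {n. gram_schmidt u n \<noteq> 0}" "j \<in> {n. gram_schmidt u n \<noteq> 0}"
  then show "cinner (gram_schmidt u i) (gram_schmidt u j) = (if i = j then 1 else 0)"
    using gram_schmidt_orthogonal[of i j u] gram_schmidt_orthogonal[of j i u] gram_schmidt_norm[of u i]
      cinner_eq_0_commute[of "gram_schmidt u i" "gram_schmidt u j"]
    by (cases i j rule: linorder_cases) (auto simp: cinner_self)
qed

text \<open>Discarding zero vectors does not shrink the span. The bound \<open>N\<close> makes the
  index set finite, as the expansion lemmas require.\<close>

lemma gram_schmidt_span:
  assumes "n < N"
  shows "u n \<in> cspan (gram_schmidt u ` {i. i < N \<and> gram_schmidt u i \<noteq> 0})"
proof -
  let ?e = "gram_schmidt u"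
  let ?S = "cspan (?e ` {i. i < N \<and> ?e i \<noteq> 0})"
  define r where "r = u n - (\<Sum>i<n. cinner (u n) (?e i) *\<^sub>C ?e i)"
  have e: "?e i \<in> ?S" if "i < N" for i
    by (cases "?e i = 0") (use that in \<open>auto intro: complex_vector.span_zero complex_vector.span_base\<close>)
  \<comment> \<open>Also true for \<open>r = 0\<close>, where both sides vanish.\<close>
  have "norm r *\<^sub>R ?e n = r"
    by (subst gram_schmidt.simps) (simp add: r_def[symmetric])
  then have "u n = complex_of_real (norm r) *\<^sub>C ?e n + (\<Sum>i<n. cinner (u n) (?e i) *\<^sub>C ?e i)"
    by (simp add: scaleC_of_real r_def)
  moreover have "\<dots> \<in> ?S"
    using assms e by (intro complex_vector.span_add complex_vector.span_sum complex_vector.span_scale) auto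
  ultimately show ?thesis
    by (simp only:)
qed

text \<open>
  By induction on the number of coordinates of \<open>p\<close> strictly between \<open>0\<close> and \<open>1\<close>: two such
  coordinates can be moved apart, keeping their sum, until one of them is \<open>0\<close> or \<open>1\<close>, and a
  rotation of the plane of the two basis vectors undoes this by the intermediate value theorem.
\<close>

lemma orthonormal_family_with_diagonal:
  fixes e :: "'i \<Rightarrow> 'a :: complex_inner" and p :: "'i \<Rightarrow> real"
  assumes J: "finite J" and on: "orthonormal_family J e"
    and "\<And>i. i \<in> J \<Longrightarrow> 0 \<le> p i" "\<And>i. i \<in> J \<Longrightarrow> p i \<le> 1" "(\<Sum>i\<in>J. p i) = real k"
  shows "\<exists>z. orthonormal_family {..<k} z \<and> z ` {..<k} \<subseteq> cspan (e ` J) \<and>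
    (\<forall>i\<in>J. (\<Sum>l<k. (cmod (cinner (z l) (e i)))\<^sup>2) = p i)"
  using assms(3-)
proof (induction "card {i \<in> J. 0 < p i \<and> p i < 1}" arbitrary: p rule: less_induct)
  case less
  define F where "F = {i \<in> J. 0 < p i \<and> p i < 1}"
  have F01: "p i = 0 \<or> p i = 1" if "i \<in> J" "i \<notin> F" for i
    using that less.prems(1,2)[of i] by (auto simp: F_def)
  show ?case
  proof (cases "F = {}")
    case True
    \<comment> \<open>All weights are 0 or 1, so exactly \<open>k\<close> of them are 1 and the
      corresponding \<open>e i\<close> serve as the family.\<close>
    define S where "S = {i \<in> J. p i = 1}"
    have pS: "p i = (if i \<in> S then 1 else 0)" if "i \<in> J" for i
      using F01[OF that] that True by (auto simp: S_def)
    have "real k = (\<Sum>i\<in>J. if i \<in> S then 1 else 0)"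
      using less.prems(3) pS by simp
    also have "\<dots> = real (card S)"
      using J by (simp add: S_def flip: sum.inter_filter)
    finally have "k = card S"
      by simp
    moreover have "finite S"
      using J by (simp add: S_def)
    ultimately obtain h where h: "bij_betw h {..<k} S"
      using ex_bij_betw_nat_finite[of S] by (auto simp: atLeast0LessThan)
    have hJ: "h l \<in> J" if "l < k" for l
      using h that by (auto simp: bij_betw_def S_def)
    have "orthonormal_family {..<k} (e \<circ> h)"
      using on hJ bij_betw_imp_inj_on[OF h]
      by (auto simp: orthonormal_family_def inj_on_eq_iff)
    moreover have "(\<Sum>l<k. (cmod (cinner ((e \<circ> h) l) (e i)))\<^sup>2) = p i" if "i \<in> J" for i
    proof -
      have "(\<Sum>l<k. (cmod (cinner ((e \<circ> h) l) (e i)))\<^sup>2) = (\<Sum>l<k. if h l = i then 1 else 0)"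
        using hJ that on by (intro sum.cong) (auto simp: orthonormal_familyD)
      also have "\<dots> = (\<Sum>s\<in>S. if s = i then 1 else 0)"
        using h by (rule sum.reindex_bij_betw)
      also have "\<dots> = p i"
        using pS[OF that] \<open>finite S\<close> by simp
      finally show ?thesis .
    qed
    ultimately show ?thesis
      using hJ by (intro exI[of _ "e \<circ> h"]) (auto intro: complex_vector.span_base)
  next
    case False
    then obtain i where i: "i \<in> F" by blast
    \<comment> \<open>A lone fractional weight would be a difference of integers.\<close>
    have "\<exists>j\<in>F. j \<noteq> i"
    proof (rule ccontr)
      assume "\<not> ?thesis"
      then have "(\<Sum>j\<in>J - {i}. p j) \<in> \<int>"
        by (intro Ints_sum) (use F01 in fastforce)
      moreover have "p i = real k - (\<Sum>j\<in>J - {i}. p j)"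
        using less.prems(3) sum.remove[OF J, of i p] i by (simp add: F_def)
      ultimately have "p i \<in> \<int>"
        by simp
      then show False
        using i by (auto simp: F_def elim!: Ints_cases)
    qed
    then obtain j where j: "j \<in> F" "j \<noteq> i" by blast
    have ij: "i \<in> J" "j \<in> J" "0 < p i" "p i < 1" "0 < p j" "p j < 1"
      using i j by (auto simp: F_def)
    \<comment> \<open>The weight at \<open>i\<close> moves to 0, or to 1 if the sum exceeds 1, and
      \<open>b\<close> takes the remainder. So \<open>p i\<close> lies between \<open>a\<close> and
      \<open>b\<close>, in an order depending on the case.\<close>
    define a where "a = (if p i + p j \<le> 1 then 0 else 1 :: real)"
    define b where "b = p i + p j - a"
    have ab: "0 \<le> b" "b \<le> 1" "a = 0 \<or> a = 1" "a + b = p i + p j"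
      "a \<le> p i \<and> p i \<le> b \<or> b \<le> p i \<and> p i \<le> a"
      using ij by (auto simp: a_def b_def)
    define q where "q = p(i := a, j := b)"
    have "{l \<in> J. 0 < q l \<and> q l < 1} \<subset> F"
      using ab i j ij by (auto simp: q_def F_def)
    then have "card {l \<in> J. 0 < q l \<and> q l < 1} < card F"
      using J by (intro psubset_card_mono) (simp_all add: F_def)
    moreover have "0 \<le> q l" "q l \<le> 1" if "l \<in> J" for l
      using less.prems(1,2)[OF that] ab by (auto simp: q_def)
    moreover have "(\<Sum>l\<in>J. q l) = real k"
    proof -
      have split: "(\<Sum>l\<in>J. f l) = f i + (f j + (\<Sum>l\<in>J - {i} - {j}. f l))" for f :: "'i \<Rightarrow> real"
        using ij J j sum.remove[of J i f] sum.remove[of "J - {i}" j f] by simp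
      show ?thesis
        using less.prems(3) ab j unfolding split[of q] split[of p] by (simp add: q_def)
    qed
    ultimately obtain z where z: "orthonormal_family {..<k} z" "z ` {..<k} \<subseteq> cspan (e ` J)"
      "\<And>l. l \<in> J \<Longrightarrow> (\<Sum>m<k. (cmod (cinner (z m) (e l)))\<^sup>2) = q l"
      using less.hyps[of q] unfolding F_def by blast
    \<comment> \<open>The \<open>i\<close>-th diagonal entry after rotation by \<open>t\<close>. A
      quarter turn brings in the \<open>j\<close>-th entry, so \<open>f\<close> runs from
      \<open>a\<close> to \<open>b\<close> and passes \<open>p i\<close>.\<close>
    define f where "f t = (\<Sum>m<k. (cmod (complex_of_real (cos t) * cinner (z m) (e i) - complex_of_real (sin t) * cinner (z m) (e j)))\<^sup>2)" for t
    have "f 0 = a" "f (pi / 2) = b"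
      using z(3)[OF ij(1)] z(3)[OF ij(2)] j by (simp_all add: f_def q_def)
    moreover have "continuous_on {0..pi / 2} f"
      unfolding f_def by (intro continuous_intros)
    ultimately obtain t where t: "f t = p i"
      using ab(5) IVT'[of f 0 "p i" "pi / 2"] IVT2'[of f "pi / 2" "p i" 0] pi_ge_zero
      by (metis divide_nonneg_pos zero_less_numeral)
    define c s where "c = complex_of_real (cos t)" and "s = complex_of_real (sin t)"
    have "c * c + s * s = complex_of_real ((cos t)\<^sup>2 + (sin t)\<^sup>2)"
      by (simp only: c_def s_def power2_eq_square of_real_add of_real_mult)
    also have "\<dots> = 1"
      unfolding sin_cos_squared_add2 by simp
    finally have cs: "c * c + s * s = 1" .
    have cnj_cs: "cnj c = c" "cnj s = s"
      by (simp_all add: c_def s_def)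
    \<comment> \<open>The rotation by \<open>t\<close> in the plane of \<open>e i\<close> and
      \<open>e j\<close>, written as the identity plus a correction in that plane.\<close>
    define R where "R x = x + ((c - 1) * cinner x (e i) - s * cinner x (e j)) *\<^sub>C e i
      + (s * cinner x (e i) + (c - 1) * cinner x (e j)) *\<^sub>C e j" for x
    have eij: "cinner (e i) (e i) = 1" "cinner (e j) (e j) = 1" "cinner (e i) (e j) = 0" "cinner (e j) (e i) = 0"
      using on ij j by (simp_all add: orthonormal_familyD)
    have R_e: "cinner (R x) (e i) = c * cinner x (e i) - s * cinner x (e j)"
      "cinner (R x) (e j) = s * cinner x (e i) + c * cinner x (e j)" for x
      unfolding R_def cinner_add_left cinner_scaleC_left eij by (simp_all add: algebra_simps)
    have R_e': "cinner (R x) (e l) = cinner x (e l)" if "l \<in> J" "l \<noteq> i" "l \<noteq> j" for x l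
      using on ij that by (simp add: R_def cinner_add_left cinner_scaleC_left orthonormal_familyD)
    have R_inner: "cinner (R x) (R y) = cinner x y" for x y
    proof -
      have "cinner (R x) (R y) = cinner (R x) y
          + cnj ((c - 1) * cinner y (e i) - s * cinner y (e j)) * cinner (R x) (e i)
          + cnj (s * cinner y (e i) + (c - 1) * cinner y (e j)) * cinner (R x) (e j)"
        by (subst (2) R_def) (simp add: cinner_add_right cinner_scaleC_right)
      also have "cinner (R x) y = cinner x y
          + ((c - 1) * cinner x (e i) - s * cinner x (e j)) * cnj (cinner y (e i))
          + (s * cinner x (e i) + (c - 1) * cinner x (e j)) * cnj (cinner y (e j))"
        unfolding R_def by (simp add: cinner_add_left cinner_scaleC_left flip: cinner_commute)
      finally have "cinner (R x) (R y) = cinner x y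
          + (c * c + s * s - 1) * (cinner x (e i) * cnj (cinner y (e i)) + cinner x (e j) * cnj (cinner y (e j)))"
        unfolding R_e by (simp add: cnj_cs algebra_simps)
      then show ?thesis
        by (simp add: cs)
    qed
    have on': "orthonormal_family {..<k} (R \<circ> z)"
      using z(1) by (simp add: orthonormal_family_def R_inner)
    have "R x \<in> cspan (e ` J)" if "x \<in> cspan (e ` J)" for x
      unfolding R_def using that complex_vector.span_base[of _ "e ` J"] ij
      by (intro complex_vector.span_add complex_vector.span_scale) auto
    then have span: "(R \<circ> z) ` {..<k} \<subseteq> cspan (e ` J)"
      using z(2) by auto
    have pi: "(\<Sum>l<k. (cmod (cinner ((R \<circ> z) l) (e i)))\<^sup>2) = p i"
      using t by (simp add: R_e f_def c_def s_def)
    \<comment> \<open>The rotation preserves the sum of the two entries, so the \<open>j\<close>-th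
      is correct once the \<open>i\<close>-th is.\<close>
    have rot: "(cmod (c * x - s * y))\<^sup>2 + (cmod (s * x + c * y))\<^sup>2 = (cmod x)\<^sup>2 + (cmod y)\<^sup>2" for x y
    proof -
      have "complex_of_real ((cmod (c * x - s * y))\<^sup>2 + (cmod (s * x + c * y))\<^sup>2)
          = (c * c + s * s) * (x * cnj x + y * cnj y)"
        unfolding of_real_add complex_norm_square by (simp add: cnj_cs algebra_simps)
      also have "\<dots> = complex_of_real ((cmod x)\<^sup>2 + (cmod y)\<^sup>2)"
        unfolding of_real_add complex_norm_square by (simp add: cs)
      finally show ?thesis
        using of_real_eq_iff by blast
    qed
    have "(\<Sum>l<k. (cmod (cinner ((R \<circ> z) l) (e i)))\<^sup>2) + (\<Sum>l<k. (cmod (cinner ((R \<circ> z) l) (e j)))\<^sup>2)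
        = (\<Sum>l<k. (cmod (cinner (z l) (e i)))\<^sup>2) + (\<Sum>l<k. (cmod (cinner (z l) (e j)))\<^sup>2)"
      by (simp add: R_e rot flip: sum.distrib)
    also have "\<dots> = p i + p j"
      using z(3)[OF ij(1)] z(3)[OF ij(2)] ab(4) j by (simp add: q_def)
    finally have pj: "(\<Sum>l<k. (cmod (cinner ((R \<circ> z) l) (e j)))\<^sup>2) = p j"
      using pi by simp
    have "(\<Sum>l<k. (cmod (cinner ((R \<circ> z) l) (e m)))\<^sup>2) = p m" if "m \<in> J" for m
      using pi pj z(3)[OF that] R_e'[OF that] by (cases "m = i \<or> m = j") (auto simp: q_def)
    then show ?thesis
      using on' span by blast
  qed
qed

section \<open>The diagonal part\<close>

lemma csubspace_joint_eigenvector: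
  assumes "\<And>j. bounded_clinear (A j)"
  shows "csubspace {x. joint_eigenvector A a x}"
  by (rule complex_vector.subspaceI)
     (auto simp: joint_eigenvector_def bounded_clinear_0[OF assms] bounded_clinear_add[OF assms]
       bounded_clinear_scaleC[OF assms] scaleC_add_right cinner_add_right cinner_scaleC_right
       distrib_left mult.commute mult.left_commute)

text \<open>
  Joint eigenvectors with different eigenvalues are orthogonal, so only vectors with the same
  eigenvalues are combined.
\<close>

lemma gram_schmidt_joint_eigenvector:
  assumes lin: "\<And>j. bounded_clinear (A j)"
    and u: "\<And>n. \<exists>a. joint_eigenvector A a (u n)"
  shows "\<exists>a. joint_eigenvector A a (gram_schmidt u n)"
proof (induction n rule: less_induct)
  case (less n)
  let ?e = "gram_schmidt u"
  obtain a where a: "joint_eigenvector A a (u n)"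
    using u by blast
  let ?V = "{x. joint_eigenvector A a x}"
  note V = csubspace_joint_eigenvector[of A a, OF lin]
  have "cinner (u n) (?e i) *\<^sub>C ?e i \<in> ?V" if i: "i < n" for i
  proof (cases "cinner (u n) (?e i) = 0")
    case True
    then show ?thesis
      using complex_vector.subspace_0[OF V] by simp
  next
    case False
    obtain b where b: "joint_eigenvector A b (?e i)"
      using less[OF i] by blast
    \<comment> \<open>Both sides are \<open>cinner (A j (u n)) (?e i)\<close>: the left by the
      eigenvector \<open>u n\<close>, the right by the adjoint condition on
      \<open>?e i\<close>.\<close>
    have "a j * cinner (u n) (?e i) = b j * cinner (u n) (?e i)" for j
      using a b by (metis cinner_scaleC_left joint_eigenvector_def)
    then have "b = a"
      using False by auto
    then show ?thesis
      using b by (intro complex_vector.subspace_scale[OF V]) simp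
  qed
  then have "u n - (\<Sum>i<n. cinner (u n) (?e i) *\<^sub>C ?e i) \<in> ?V"
    using a by (intro complex_vector.subspace_diff[OF V] complex_vector.subspace_sum[OF V]) auto
  then have "?e n \<in> ?V"
    by (subst gram_schmidt.simps) (simp only: Let_def complex_vector.subspace_scale[OF V] flip: scaleC_of_real)
  then show ?case
    by blast
qed

text \<open>Expand the second argument and apply the adjoint half of
  \<open>joint_eigenvector\<close>. What remains is linear in the weights, which makes convex
  combinations accessible.\<close>

lemma joint_form_expansion:
  assumes "finite J" "orthonormal_family J e" "\<And>i. i \<in> J \<Longrightarrow> joint_eigenvector A (d i) (e i)"
    and x: "x \<in> cspan (e ` J)"
  shows "joint_form A x = (\<Sum>i\<in>J. (cmod (cinner x (e i)))\<^sup>2 *\<^sub>R (\<chi> j. d i j))"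
proof -
  have "cinner (A j x) x = (\<Sum>i\<in>J. complex_of_real ((cmod (cinner x (e i)))\<^sup>2) * d i j)" for j
  proof -
    have "cinner (A j x) x = cinner (A j x) (\<Sum>i\<in>J. cinner x (e i) *\<^sub>C e i)"
      by (rule arg_cong[OF orthonormal_expansion[OF assms(1,2) x]])
    also have "\<dots> = (\<Sum>i\<in>J. cnj (cinner x (e i)) * cinner (A j x) (e i))"
      by (simp add: cinner_sum_right cinner_scaleC_right)
    also have "\<dots> = (\<Sum>i\<in>J. complex_of_real ((cmod (cinner x (e i)))\<^sup>2) * d i j)"
      using assms(3) unfolding complex_norm_square by (intro sum.cong) (simp_all add: joint_eigenvector_def)
    finally show ?thesis .
  qed
  then show ?thesis
    by (simp add: vec_eq_iff joint_form_def scaleR_conv_of_real[where 'a = complex])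
qed

text \<open>
  A point of the convex hull is \<open>\<Sum>i\<in>J. p i *\<^sub>R d i\<close> with \<open>0 \<le> p i \<le> 1\<close> and \<open>sum p J = k\<close>: a convex
  combination of such weights again has these properties.
\<close>

lemma convex_hull_joint_form_sums:
  fixes A :: "'m :: finite \<Rightarrow> 'a :: complex_inner \<Rightarrow> 'a" and k :: nat
  assumes J: "finite J" and on: "orthonormal_family J e"
    and eig: "\<And>i. i \<in> J \<Longrightarrow> joint_eigenvector A (d i) (e i)"
    and E: "finite E" and X: "\<And>v. v \<in> E \<Longrightarrow> orthonormal_family {..<k} (X v)"
      "\<And>v l. v \<in> E \<Longrightarrow> l < k \<Longrightarrow> X v l \<in> cspan (e ` J)"
      "\<And>v. v \<in> E \<Longrightarrow> v = (\<Sum>l<k. joint_form A (X v l))"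
    and p: "p \<in> convex hull E"
  obtains z where "orthonormal_family {..<k} z" "z ` {..<k} \<subseteq> cspan (e ` J)"
    "p = (\<Sum>l<k. joint_form A (z l))"
proof -
  define \<delta> where "\<delta> i = (\<chi> j. d i j)" for i
  define q where "q v i = (\<Sum>l<k. (cmod (cinner (X v l) (e i)))\<^sup>2)" for v i
  obtain t where t: "\<And>v. v \<in> E \<Longrightarrow> 0 \<le> t v" "sum t E = 1" "p = (\<Sum>v\<in>E. t v *\<^sub>R v)"
    using p unfolding convex_hull_finite[OF E] by blast
  define r where "r i = (\<Sum>v\<in>E. t v * q v i)" for i
  have form_sum: "(\<Sum>l<k. joint_form A (x l)) = (\<Sum>i\<in>J. (\<Sum>l<k. (cmod (cinner (x l) (e i)))\<^sup>2) *\<^sub>R \<delta> i)"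
    if "\<And>l. l < k \<Longrightarrow> x l \<in> cspan (e ` J)" for x
  proof -
    have "(\<Sum>l<k. joint_form A (x l)) = (\<Sum>l<k. \<Sum>i\<in>J. (cmod (cinner (x l) (e i)))\<^sup>2 *\<^sub>R \<delta> i)"
      unfolding \<delta>_def using joint_form_expansion[OF J on eig] that by (intro sum.cong) auto
    also have "\<dots> = (\<Sum>i\<in>J. \<Sum>l<k. (cmod (cinner (x l) (e i)))\<^sup>2 *\<^sub>R \<delta> i)"
      by (rule sum.swap)
    finally show ?thesis
      by (simp add: scaleR_sum_left)
  qed
  \<comment> \<open>Bessel with exchanged roles: \<open>e i\<close> is the vector and
    \<open>X v\<close> the family.\<close>
  have q: "q v i \<le> 1" if "v \<in> E" "i \<in> J" for v i
    using orthonormal_bessel[OF finite_lessThan X(1)[OF that(1)], of "e i"] orthonormal_family_norm[OF on that(2)]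
    by (simp add: q_def)
  have q_sum: "(\<Sum>i\<in>J. q v i) = real k" if v: "v \<in> E" for v
  proof -
    have "(\<Sum>i\<in>J. q v i) = (\<Sum>l<k. \<Sum>i\<in>J. (cmod (cinner (X v l) (e i)))\<^sup>2)"
      unfolding q_def by (rule sum.swap)
    also have "\<dots> = (\<Sum>l<k. 1)"
      using orthonormal_parseval[OF J on X(2)[OF v]] orthonormal_family_norm[OF X(1)[OF v]]
      by (intro sum.cong) auto
    finally show ?thesis by simp
  qed
  have "0 \<le> r i" for i
    unfolding r_def q_def using t(1) by (intro sum_nonneg mult_nonneg_nonneg) auto
  moreover have "r i \<le> 1" if "i \<in> J" for i
  proof -
    have "r i \<le> (\<Sum>v\<in>E. t v * 1)"
      unfolding r_def using t(1) q that by (intro sum_mono mult_left_mono) auto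
    then show ?thesis using t(2) by simp
  qed
  moreover have "(\<Sum>i\<in>J. r i) = real k"
  proof -
    have "(\<Sum>i\<in>J. r i) = (\<Sum>v\<in>E. \<Sum>i\<in>J. t v * q v i)"
      unfolding r_def by (rule sum.swap)
    also have "\<dots> = (\<Sum>v\<in>E. t v * real k)"
      using q_sum by (simp flip: sum_distrib_left)
    finally show ?thesis
      using t(2) by (simp flip: sum_distrib_right)
  qed
  ultimately obtain z where z: "orthonormal_family {..<k} z" "z ` {..<k} \<subseteq> cspan (e ` J)"
    "\<And>i. i \<in> J \<Longrightarrow> (\<Sum>l<k. (cmod (cinner (z l) (e i)))\<^sup>2) = r i"
    using orthonormal_family_with_diagonal[OF J on, of r k] by blast
  have "p = (\<Sum>v\<in>E. t v *\<^sub>R (\<Sum>i\<in>J. q v i *\<^sub>R \<delta> i))"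
    unfolding t(3) q_def using X(3) form_sum X(2) by (intro sum.cong) auto
  also have "\<dots> = (\<Sum>v\<in>E. \<Sum>i\<in>J. (t v * q v i) *\<^sub>R \<delta> i)"
    by (simp add: scaleR_sum_right)
  also have "\<dots> = (\<Sum>i\<in>J. \<Sum>v\<in>E. (t v * q v i) *\<^sub>R \<delta> i)"
    by (rule sum.swap)
  also have "\<dots> = (\<Sum>i\<in>J. r i *\<^sub>R \<delta> i)"
    by (simp add: r_def scaleR_sum_left)
  also have "\<dots> = (\<Sum>l<k. joint_form A (z l))"
    using form_sum[of z] z(2,3) by (simp add: image_subset_iff)
  finally show ?thesis
    using that z by blast
qed

text \<open>The eigenvector equations make the span invariant, and continuity passes this on to
  \<open>M\<close>; the adjoint equations make the complement invariant.\<close>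

lemma direct_sum_on_closure_joint_eigenvectors:
  assumes lin: "\<And>j. bounded_clinear (A j)"
    and eig: "\<And>i. i \<in> I \<Longrightarrow> joint_eigenvector A (d i) (e i)"
    and M: "M = closure (cspan (e ` I))"
  shows "direct_sum_on M (A j) (A j) (A j)"
  unfolding direct_sum_on_def
proof (intro conjI ballI)
  have "csubspace {x. A j x \<in> cspan (e ` I)}"
    by (rule complex_vector.subspaceI)
       (simp_all add: bounded_clinear_0[OF lin] bounded_clinear_add[OF lin] bounded_clinear_scaleC[OF lin]
         complex_vector.span_zero complex_vector.span_add complex_vector.span_scale)
  moreover have "e ` I \<subseteq> {x. A j x \<in> cspan (e ` I)}"
    using eig complex_vector.span_base[of _ "e ` I"]
    by (auto simp: joint_eigenvector_def intro!: complex_vector.span_scale)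
  ultimately have "cspan (e ` I) \<subseteq> {x. A j x \<in> cspan (e ` I)}"
    by (intro complex_vector.span_minimal)
  then show "A j ` M \<subseteq> M"
    unfolding M using lin closure_subset[of "cspan (e ` I)"]
    by (intro image_closure_subset) (auto simp: bounded_clinear_def intro: linear_continuous_on)
  show "A j ` ortho_compl M \<subseteq> ortho_compl M"
  proof (rule image_subsetI)
    fix y assume y: "y \<in> ortho_compl M"
    have "e i \<in> M" if "i \<in> I" for i
      unfolding M using that closure_subset complex_vector.span_base[of "e i" "e ` I"] by blast
    then have "cinner (A j y) (e i) = 0" if "i \<in> I" for i
      using that eig[OF that] y cinner_eq_0_commute[of "e i" y]
      by (simp add: joint_eigenvector_def ortho_compl_def)
    then have "e ` I \<subseteq> {x. cinner x (A j y) = 0}"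
      using cinner_eq_0_commute by blast
    then have "cspan (e ` I) \<subseteq> {x. cinner x (A j y) = 0}"
      by (intro complex_vector.span_minimal csubspace_cinner_left_eq_0)
    moreover have "closed {x. cinner x (A j y) = 0}"
      by (intro closed_Collect_eq continuous_on_cinner_left continuous_on_const)
    ultimately have "M \<subseteq> {x. cinner x (A j y) = 0}"
      unfolding M by (rule closure_minimal)
    then show "A j y \<in> ortho_compl M"
      by (auto simp: ortho_compl_def)
  qed
qed (simp add: bounded_clinear_add[OF lin])

lemma joint_numrange_on_mono: "M \<subseteq> M' \<Longrightarrow> joint_numrange_on M k A \<subseteq> joint_numrange_on M' k A"
  unfolding joint_numrange_on_eq by blast

text \<open>Each hull has finitely many vertices, each attained at \<open>k\<close> joint
  eigenvectors, so countably many of these span a suitable \<open>M\<close>. \<open>K\<close> is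
  downward closed because the vertices for \<open>k\<close> are reached by induction on
  \<open>k\<close>.\<close>

lemma polytope_convex_hull_numranges_diagonal_part:
  fixes A :: "'m :: finite \<Rightarrow> 'a :: complex_inner \<Rightarrow> 'a"
  assumes lin: "\<And>j. bounded_clinear (A j)"
    and down: "\<forall>k\<in>K. 0 < k \<and> {0<..k} \<subseteq> K"
    and poly: "\<forall>k\<in>K. polytope (convex hull (joint_numrange k A))"
  obtains e :: "nat \<Rightarrow> 'a" and I d M where "orthonormal_basis_of M I e" "csubspace M"
    "\<And>i. i \<in> I \<Longrightarrow> joint_eigenvector A (d i) (e i)"
    "\<And>k. k \<in> K \<Longrightarrow> joint_numrange k A = joint_numrange_on M k A"
    "\<And>k. k \<in> K \<Longrightarrow> joint_numrange_on M k A = convex hull (joint_numrange k A)"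
proof -
  define E where "E k = {v. v extreme_point_of (convex hull (joint_numrange k A))}" for k
  have E: "finite (E k)" "convex hull (joint_numrange k A) = convex hull (E k)" if "k \<in> K" for k
    using polytope_finite_extreme_points[OF poly[rule_format, OF that]]
      polytope_eq_convex_hull_extreme_points[OF poly[rule_format, OF that]] by (simp_all only: E_def)
  have "\<exists>x. orthonormal_family {..<k} x \<and> v = (\<Sum>l<k. joint_form A (x l)) \<and>
      (\<forall>l<k. \<exists>a. joint_eigenvector A a (x l))" if "k \<in> K" "v \<in> E k" for k v
  proof -
    have "polytope (convex hull (joint_numrange i A))" if "0 < i" "i \<le> k" for i
    proof -
      have "i \<in> K"
        using down \<open>k \<in> K\<close> that by (meson greaterThanAtMost_iff subsetD)
      then show ?thesis
        using poly by blast
    qed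
    moreover have "0 < k" "v extreme_point_of (convex hull (joint_numrange k A))"
      using down that by (auto simp: E_def)
    ultimately show ?thesis
      using polytope_extreme_point_joint_eigenvectors[of A k v, OF lin] by metis
  qed
  then obtain X where X: "\<And>k v. k \<in> K \<Longrightarrow> v \<in> E k \<Longrightarrow> orthonormal_family {..<k} (X k v)"
    "\<And>k v. k \<in> K \<Longrightarrow> v \<in> E k \<Longrightarrow> v = (\<Sum>l<k. joint_form A (X k v l))"
    "\<And>k v l. k \<in> K \<Longrightarrow> v \<in> E k \<Longrightarrow> l < k \<Longrightarrow> \<exists>a. joint_eigenvector A a (X k v l)"
    by metis
  \<comment> \<open>\<open>0\<close> makes the set nonempty, so that a sequence enumerates it. It is
    a joint eigenvector for all eigenvalues, and \<open>I\<close> omits the zero vectors produced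
    from it.\<close>
  define S where "S = insert 0 (\<Union>k\<in>K. \<Union>v\<in>E k. X k v ` {..<k})"
  have "countable S"
    unfolding S_def using E(1) by (intro countable_insert countable_UN) (auto intro: countable_finite)
  define u where "u = from_nat_into S"
  have u: "range u = S"
    unfolding u_def using \<open>countable S\<close> by (intro range_from_nat_into) (simp_all add: S_def)
  have "joint_eigenvector A a 0" for a
    using complex_vector.subspace_0[OF csubspace_joint_eigenvector[of A a, OF lin]] by simp
  then have "\<exists>a. joint_eigenvector A a x" if "x \<in> S" for x
    using that X(3) by (auto simp: S_def)
  then have "\<exists>a. joint_eigenvector A a (u n)" for n
    using u by blast
  then obtain d where d: "\<And>n. joint_eigenvector A (d n) (gram_schmidt u n)"
    using gram_schmidt_joint_eigenvector[of A u, OF lin] by metis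
  let ?e = "gram_schmidt u"
  define I where "I = {n. ?e n \<noteq> 0}"
  define M where "M = closure (cspan (?e ` I))"
  have onI: "orthonormal_family I ?e"
    unfolding I_def by (rule gram_schmidt_orthonormal)
  have sub: "convex hull (joint_numrange k A) \<subseteq> joint_numrange_on M k A" if k: "k \<in> K" for k
  proof
    fix p assume p: "p \<in> convex hull (joint_numrange k A)"
    have "(\<Union>v\<in>E k. X k v ` {..<k}) \<subseteq> range u"
      unfolding u S_def using k by blast
    moreover have "finite (\<Union>v\<in>E k. X k v ` {..<k})"
      using E(1)[OF k] by simp
    \<comment> \<open>For fixed \<open>k\<close> finitely many \<open>u n\<close> occur, so a finite
      part \<open>J\<close> of the basis already spans them.\<close>
    ultimately obtain F where F: "finite F" "(\<Union>v\<in>E k. X k v ` {..<k}) = u ` F"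
      by (meson finite_subset_image)
    then obtain N where N: "\<And>n. n \<in> F \<Longrightarrow> n < N"
      using finite_nat_set_iff_bounded[THEN iffD1, OF F(1)] by blast
    define J where "J = {i. i < N \<and> ?e i \<noteq> 0}"
    have XJ: "X k v l \<in> cspan (?e ` J)" if "v \<in> E k" "l < k" for v l
    proof -
      have "X k v l \<in> u ` F"
        using F(2) that by blast
      then show ?thesis
        unfolding J_def using gram_schmidt_span[OF N] by auto
    qed
    have onJ: "orthonormal_family J ?e"
      using onI by (rule orthonormal_family_mono) (auto simp: J_def I_def)
    have J: "finite J"
      by (simp add: J_def)
    obtain z where z: "orthonormal_family {..<k} z" "z ` {..<k} \<subseteq> cspan (?e ` J)"
        "p = (\<Sum>l<k. joint_form A (z l))"
      using convex_hull_joint_form_sums[OF J onJ d E(1)[OF k] X(1)[OF k] XJ X(2)[OF k] p[unfolded E(2)[OF k]]]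
      by blast
    have "cspan (?e ` J) \<subseteq> M"
    proof -
      have "?e ` J \<subseteq> ?e ` I"
        by (auto simp: J_def I_def)
      then show ?thesis
        unfolding M_def using complex_vector.span_mono closure_subset by blast
    qed
    with z show "p \<in> joint_numrange_on M k A"
      unfolding joint_numrange_on_eq by blast
  qed
  \<comment> \<open>Together with \<open>sub\<close> the inclusions form a cycle, so all three sets
    coincide.\<close>
  have "joint_numrange_on M k A \<subseteq> joint_numrange k A" for k
    by (rule joint_numrange_on_mono) simp
  moreover have "joint_numrange k A \<subseteq> convex hull (joint_numrange k A)" for k
    by (rule hull_subset)
  ultimately have "joint_numrange k A = joint_numrange_on M k A"
      "joint_numrange_on M k A = convex hull (joint_numrange k A)" if "k \<in> K" for k
    using sub[OF that] by blast+
  moreover have "orthonormal_basis_of M I ?e"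
    using onI by (simp add: orthonormal_basis_of_def M_def)
  moreover have "csubspace M"
    unfolding M_def by (intro csubspace_closure complex_vector.subspace_span)
  ultimately show ?thesis
    using that d by blast
qed

section \<open>The cycle of implications from (a) to (b) to (c) and back\<close>

theorem theorem7p2:
  fixes A :: "'m :: finite \<Rightarrow> 'a :: chilbert_space \<Rightarrow> 'a"
  assumes "\<And>j. bounded_clinear (A j)"
  shows
    "((\<forall>k. 0 < k \<and> enat k < hdim TYPE('a) \<longrightarrow> polytope (joint_numrange k A))
      \<longleftrightarrow>
      (\<forall>k. 0 < k \<and> enat k < hdim TYPE('a) \<longrightarrow> polytope (convex hull (joint_numrange k A))))
     \<and>
     ((\<forall>k. 0 < k \<and> enat k < hdim TYPE('a) \<longrightarrow> polytope (convex hull (joint_numrange k A)))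
      \<longleftrightarrow>
      (\<exists>(U :: 'a \<Rightarrow> 'a) (M :: 'a set) (D :: 'm \<Rightarrow> 'a \<Rightarrow> 'a) (C :: 'm \<Rightarrow> 'a \<Rightarrow> 'a)
         (I :: nat set) (e :: nat \<Rightarrow> 'a) (d :: 'm \<Rightarrow> nat \<Rightarrow> complex).
         unitary U \<and>
         csubspace M \<and> closed M \<and>
         (\<forall>j. direct_sum_on M (cadjoint U \<circ> A j \<circ> U) (D j) (C j)) \<and>
         orthonormal_basis_of M I e \<and>
         (\<forall>j. \<forall>i\<in>I. D j (e i) = d j i *\<^sub>C e i) \<and>
         (\<forall>k. 0 < k \<and> enat k < hdim TYPE('a) \<longrightarrow>
            joint_numrange k A = joint_numrange_on M k D \<and>
            polytope (joint_numrange_on M k D))))"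
proof -
  let ?K = "{k. 0 < k \<and> enat k < hdim TYPE('a)}"
  let ?a = "\<forall>k. 0 < k \<and> enat k < hdim TYPE('a) \<longrightarrow> polytope (joint_numrange k A)"
  let ?b = "\<forall>k. 0 < k \<and> enat k < hdim TYPE('a) \<longrightarrow> polytope (convex hull (joint_numrange k A))"
  let ?c = "\<exists>(U :: 'a \<Rightarrow> 'a) (M :: 'a set) (D :: 'm \<Rightarrow> 'a \<Rightarrow> 'a) (C :: 'm \<Rightarrow> 'a \<Rightarrow> 'a)
         (I :: nat set) (e :: nat \<Rightarrow> 'a) (d :: 'm \<Rightarrow> nat \<Rightarrow> complex).
         unitary U \<and>
         csubspace M \<and> closed M \<and>
         (\<forall>j. direct_sum_on M (cadjoint U \<circ> A j \<circ> U) (D j) (C j)) \<and>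
         orthonormal_basis_of M I e \<and>
         (\<forall>j. \<forall>i\<in>I. D j (e i) = d j i *\<^sub>C e i) \<and>
         (\<forall>k. 0 < k \<and> enat k < hdim TYPE('a) \<longrightarrow>
            joint_numrange k A = joint_numrange_on M k D \<and>
            polytope (joint_numrange_on M k D))"
  note lin = assms
  \<comment> \<open>A polytope is convex, hence its own hull.\<close>
  have ab: "?b" if ?a
    using that by (simp add: convex_hull_eq[THEN iffD2] polytope_imp_convex)
  have bc: "?c" if b: ?b
  proof -
    have down: "\<forall>k\<in>?K. 0 < k \<and> {0<..k} \<subseteq> ?K"
      by (auto intro: order.strict_trans1[of "enat _" "enat _"])
    have poly: "\<forall>k\<in>?K. polytope (convex hull (joint_numrange k A))"
      using b by simp
    obtain e :: "nat \<Rightarrow> 'a" and I d M where basis: "orthonormal_basis_of M I e" and M: "csubspace M"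
      and eig: "\<And>i. i \<in> I \<Longrightarrow> joint_eigenvector A (d i) (e i)"
      and W: "\<And>k. k \<in> ?K \<Longrightarrow> joint_numrange k A = joint_numrange_on M k A"
        "\<And>k. k \<in> ?K \<Longrightarrow> joint_numrange_on M k A = convex hull (joint_numrange k A)"
      by (rule polytope_convex_hull_numranges_diagonal_part[of A ?K, OF lin down poly]) (rule that)
    have M_eq: "M = closure (cspan (e ` I))"
      using basis by (simp add: orthonormal_basis_of_def)
    then have "closed M"
      by simp
    show ?thesis
    \<comment> \<open>\<open>A\<close> serves as both summands, since only the values of
      \<open>D\<close> on \<open>M\<close> and of \<open>C\<close> on its complement enter.\<close>
    proof (rule exI[of _ id], rule exI[of _ M], rule exI[of _ A], rule exI[of _ A], rule exI[of _ I],
        rule exI[of _ e], rule exI[of _ "\<lambda>j i. d i j"], intro conjI allI ballI impI)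
      show "direct_sum_on M (cadjoint id \<circ> A j \<circ> id) (A j) (A j)" for j
        using direct_sum_on_closure_joint_eigenvectors[of A I d e M j, OF lin eig M_eq]
        by (simp add: cadjoint_id)
      show "A j (e i) = d i j *\<^sub>C e i" if "i \<in> I" for i j
        using eig[OF that] by (simp add: joint_eigenvector_def)
      fix k assume "0 < k \<and> enat k < hdim TYPE('a)"
      then have k: "k \<in> ?K"
        by simp
      show "joint_numrange k A = joint_numrange_on M k A"
        by (rule W(1)[OF k])
      show "polytope (joint_numrange_on M k A)"
        unfolding W(2)[OF k] using poly k by (rule bspec)
    qed (fact unitary_id M \<open>closed M\<close> basis)+
  qed
  have ca: "?a" if ?c
    using that by (elim exE conjE) metis
  show ?thesis
    using ab bc ca by blast
qed

end
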